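(* Equip $\mathcal{D}_2^+\oplus\mathcal{D}_2^-$ with the inner product described in the context. Then there exists a unitary operator (surjective linear isometry of pre-Hilbert spaces) $U:\mathcal{H}_L\to\mathcal{D}_2^+\oplus\mathcal{D}_2^-$ such that $C(b)=U\,C_L(b)$ for all $b\in\mathcal{B}=\mathcal{O}_q(S_t^2)$.
   Context: Fix $0<q<1$, $a\in\mathbb{R}$, $t=q^a-q^{-a}$. Put $[x]=\frac{q^x-q^{-x}}{q-q^{-1}}$, $\{x\}=q^x+q^{-x}$ and $i=\sqrt{-1}$. Inner products are linear in the second variable. $U_q=U_q(\mathfrak{su}(2))$ is the Hopf $*$-algebra generated by $k^{\pm1},e,f$ with $ke=q^2ek$, $kf=q^{-2}fk$, $[e,f]=\frac{k-k^{-1}}{q-q^{-1}}$, $\Delta(k)=k\otimes k$, $\Delta(e)=e\otimes1+k\otimes e$, $\Delta(f)=1\otimes f+f\otimes k^{-1}$, $\epsilon(k)=1$, $\epsilon(e)=\epsilon(f)=0$, $S(k)=k^{-1}$, $S(e)=-k^{-1}e$, $S(f)=-fk$, $k^*=k$, $e^*=fk$, $f^*=k^{-1}e$. For $s\in\frac12\mathbb{Z}_{\ge0}$, $(\pi_s,H_s)$ is the $*$-representation with orthonormal basis $\xi^s_j$ ($j=-s,\dots,s$), $\pi_s(k)\xi^s_j=q^{2j}\xi^s_j$, $\pi_s(e)\xi^s_j=q^{j+1}([s-j][s+j+1])^{1/2}\xi^s_{j+1}$, $\pi_s(f)\xi^s_j=q^{-j}([s+j][s-j+1])^{1/2}\xi^s_{j-1}$.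 $\mathcal{A}=\mathcal{O}_q(SU(2))$ is the dual Hopf $*$-algebra spanned by the matrix coefficients $u^s_{\xi,\eta}$, $(u^s_{\xi,\eta},h)=\langle\xi,\pi_s(h)\eta\rangle$, with product dual to $\Delta$, coproduct dual to the product of $U_q$, counit $\epsilon(u)=(u,1)$, and $(x^*,h)=\overline{(x,S(h)^* )}$. For $h\in U_q$, $x\in\mathcal{A}$ put $h\rhd x=x_{(1)}(x_{(2)},h)$ and $x\lhd h=(x_{(1)},h)x_{(2)}$. Let $B_t=q^{-1/2}(e-fk)-i(q-q^{-1})^{-1}tk$, and let $R$ be the unitary antipode of $U_q$ (the $*$-preserving anti-automorphism with $R(k)=k^{-1}$, $R(e)=-qk^{-1}e$, $R(f)=-q^{-1}fk$). Let $I=\mathbb{C}[R(B_t)]$, a right coideal of $U_q$. The Podleś sphere is the unital left coideal $*$-subalgebra $\mathcal{B}=\mathcal{O}_q(S_t^2)=\{x\in\mathcal{A}: R(B_t)\rhd x=\epsilon(B_t)x\}$. For $n\in\mathbb{Z}_{\ge0}$ the operator $\pi_n(iR(B_t))$ is self-adjoint with simple eigenvalues $[a+2j]$, $j=-n,\dots,n$; let $\eta^n_{[a+2j]}\in H_n$ be unit eigenvectors and $u^n_{[a+2j],[a]}=u^n_{\eta^n_{[a+2j]},\eta^n_{[a]}}$. These elements ($n\ge0$, $|j|\le n$) form a basis of $\mathcal{B}$. An admissible $*$-representation (of $\mathcal{B}\bowtie I$) is a pre-Hilbert space with $*$-representations of $\mathcal{B}$ and $I$ by adjointable operators such that $bh=h_{(1)}(b\lhd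 h_{(2)})$ for $b\in\mathcal{B},h\in I$, and on which $iR(B_t)$ is diagonalizable with eigenvalues (weights) in $\{[a+n]:n\in\mathbb{Z}\}$, each of finite multiplicity. For $0<\lambda<q+q^{-1}$, $\mathcal{L}_\lambda^+=(\pi_\lambda,\mathcal{L}^+_\lambda)$ is the irreducible admissible $*$-representation (unique up to unitary equivalence) with weights $[a+2n]$, $n\in\mathbb{Z}$, each of multiplicity one, whose unit vector $e_a^\lambda$ of weight $[a]$ satisfies $$\pi_\lambda(u^1_{[a],[a]})e_a^\lambda=\frac{\lambda+(q+q^{-1})^{-1}t^2}{q+q^{-1}+(q+q^{-1})^{-1}t^2}\,e_a^\lambda .$$ Put $\omega_\lambda(b)=\langle e^\lambda_a,\pi_\lambda(b)e^\lambda_a\rangle$ and $$\kappa=\frac{\{a+2\}}{\{a\}(\{2a+1\}+q+q^{-1})},\qquad L(b)=\kappa\lim_{\lambda\uparrow q+q^{-1}}\frac{\omega_\lambda(b)-\epsilon(b)}{q+q^{-1}-\lambda}\quad(b\in\mathcal{B}).$$ $L$ is a generating functional (i.e. $L(x^*x)\ge 0$ if $\epsilon(x)=0$, $L(x^* )=\overline{L(x)}$, $L(1)=0$). Put $\langle x,y\rangle_L=L((x-\epsilon(x)1)^*(y-\epsilon(y)1))$, $N_L=\{x\in\mathcal{B}:\langle x,x\rangle_L=0\}$, $\mathcal{H}_L=\mathcal{B}/N_L$ with the induced inner product, and let $C_L:\mathcal{B}\to\mathcal{H}_L$ be the canonical map. The module $\mathcal{M}_{q+q^{-1},a}$ is the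 module of $\mathcal{B}\bowtie I$ generated by a vector $e_a$ of weight $[a]$ with $u^1_{[a],[a]}e_a=e_a$, universal with this property; it has one-dimensional weight spaces of weights $[a+2n]$, $n\in\mathbb{Z}$, and as a $\mathcal{B}$-module it is $\mathcal{B}/\mathcal{B}(1-u^1_{[a],[a]})$ with $e_a$ the class of $1$. The sum of the discrete series $\mathcal{D}_2^+$ (weights $[a+2n]$, $n\ge1$) and $\mathcal{D}_2^-$ (weights $[a+2n]$, $n\le-1$) is the submodule $\mathcal{D}_2^+\oplus\mathcal{D}_2^-=\ker(\epsilon|_{\mathcal{B}})e_a$, of codimension one, with quotient the trivial representation. The 1-cocycle $C:\mathcal{B}\to\mathcal{D}_2^+\oplus\mathcal{D}_2^-$ is $C(b)=be_a-\epsilon(b)e_a$. The invariant inner product on $\mathcal{D}_2^+\oplus\mathcal{D}_2^-$ is the (well-defined, positive definite) one given by $$\langle C(x),C(y)\rangle=\lim_{\lambda\uparrow q+q^{-1}}\kappa\,\frac{\langle\pi_\lambda(x)e_a^\lambda-\epsilon(x)e_a^\lambda,\ \pi_\lambda(y)e_a^\lambda-\epsilon(y)e_a^\lambda\rangle}{q+q^{-1}-\lambda},\qquad x,y\in\mathcal{B}.$$ *)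

theory Defs
  imports
    Complex_Main
    "HOL-Library.Poly_Mapping"
    "HOL-Library.Product_Plus"
    "HOL-Library.Function_Algebras"
    "HOL-Algebra.Module"
begin

section \<open>The Hopf $*$-algebra $U_q(\mathfrak{su}(2))$\<close>

definition qnum :: "real \<Rightarrow> real \<Rightarrow> real" where
  "qnum q x = (q powr x - q powr (- x)) / (q - inverse q)"

definition qbrace :: "real \<Rightarrow> real \<Rightarrow> real" where
  "qbrace q x = q powr x + q powr (- x)"

datatype qgen = QK | QKi | QE | QF

text \<open>
  Words under concatenation form the free monoid.  It is written additively because that is what
  \<^type>\<open>poly_mapping\<close> uses to build monoid algebras: \<open>qgen list \<Rightarrow>\<^sub>0 complex\<close> is the free unital
  algebra on \<open>k, k\<^sup>-\<^sup>1, e, f\<close>, and the monoid algebra of the product of two copies of the free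
  monoid is the tensor square of that free algebra.
\<close>

instantiation list :: (type) monoid_add
begin
definition zero_list :: "'a list" where "zero_list = []"
definition plus_list :: "'a list \<Rightarrow> 'a list \<Rightarrow> 'a list" where "plus_list = append"
instance by standard (simp_all add: zero_list_def plus_list_def)
end

type_synonym free_alg = "qgen list \<Rightarrow>\<^sub>0 complex"
type_synonym free_alg2 = "(qgen list \<times> qgen list) \<Rightarrow>\<^sub>0 complex"

definition cst :: "complex \<Rightarrow> ('w::zero \<Rightarrow>\<^sub>0 complex)" where
  "cst c = Poly_Mapping.single 0 c"

definition gen :: "qgen \<Rightarrow> free_alg" where
  "gen g = Poly_Mapping.single [g] 1"

definition tens :: "free_alg \<Rightarrow> free_alg \<Rightarrow> free_alg2" where
  "tens x y = (\<Sum>v\<in>Poly_Mapping.keys x. \<Sum>w\<in>Poly_Mapping.keys y.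
     Poly_Mapping.single (v, w) (Poly_Mapping.lookup x v * Poly_Mapping.lookup y w))"

definition gen_ideal :: "'r::ring_1 set \<Rightarrow> 'r set" where
  "gen_ideal S = {\<Sum>(x, r, y)\<leftarrow>zs. x * r * y | zs. set zs \<subseteq> UNIV \<times> S \<times> UNIV}"

definition relators :: "real \<Rightarrow> free_alg set" where
  "relators q =
    {gen QK * gen QKi - 1, gen QKi * gen QK - 1,
     gen QK * gen QE - cst (of_real (q\<^sup>2)) * gen QE * gen QK,
     gen QK * gen QF - cst (of_real (inverse (q\<^sup>2))) * gen QF * gen QK,
     gen QE * gen QF - gen QF * gen QE
       - cst (of_real (inverse (q - inverse q))) * (gen QK - gen QKi)}"

text \<open>
  \<open>U\<^sub>q\<close> is the quotient of the free algebra by \<open>uq_ideal q\<close>, and \<open>U\<^sub>q \<otimes> U\<^sub>q\<close> is the quotient of its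
  tensor square by \<open>uq_ideal2 q\<close>.  Elements of \<open>U\<^sub>q\<close> are given below by representatives in the free
  algebra.  The operations \<open>\<Delta>, \<epsilon>, S, *, R\<close> are the (anti)multiplicative extensions of their values
  on generators to the free algebra; they descend to the quotients.
\<close>

definition uq_ideal :: "real \<Rightarrow> free_alg set" where
  "uq_ideal q = gen_ideal (relators q)"

definition uq_ideal2 :: "real \<Rightarrow> free_alg2 set" where
  "uq_ideal2 q = gen_ideal ((\<lambda>r. tens r 1) ` relators q \<union> (\<lambda>r. tens 1 r) ` relators q)"

definition anti_ext :: "(complex \<Rightarrow> complex) \<Rightarrow> (qgen \<Rightarrow> free_alg) \<Rightarrow> free_alg \<Rightarrow> free_alg" where
  "anti_ext \<sigma> \<phi> x = (\<Sum>w\<in>Poly_Mapping.keys x.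
     cst (\<sigma> (Poly_Mapping.lookup x w)) * prod_list (rev (map \<phi> w)))"

primrec Delta_gen :: "qgen \<Rightarrow> free_alg2" where
  "Delta_gen QK = tens (gen QK) (gen QK)"
| "Delta_gen QKi = tens (gen QKi) (gen QKi)"
| "Delta_gen QE = tens (gen QE) 1 + tens (gen QK) (gen QE)"
| "Delta_gen QF = tens 1 (gen QF) + tens (gen QF) (gen QKi)"

definition Delta :: "free_alg \<Rightarrow> free_alg2" where
  "Delta x = (\<Sum>w\<in>Poly_Mapping.keys x.
     cst (Poly_Mapping.lookup x w) * prod_list (map Delta_gen w))"

primrec counit_gen :: "qgen \<Rightarrow> complex" where
  "counit_gen QK = 1"
| "counit_gen QKi = 1"
| "counit_gen QE = 0"
| "counit_gen QF = 0"

definition counit :: "free_alg \<Rightarrow> complex" where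
  "counit x = (\<Sum>w\<in>Poly_Mapping.keys x.
     Poly_Mapping.lookup x w * prod_list (map counit_gen w))"

primrec antipode_gen :: "qgen \<Rightarrow> free_alg" where
  "antipode_gen QK = gen QKi"
| "antipode_gen QKi = gen QK"
| "antipode_gen QE = - (gen QKi * gen QE)"
| "antipode_gen QF = - (gen QF * gen QK)"

definition antipode :: "free_alg \<Rightarrow> free_alg" where
  "antipode = anti_ext (\<lambda>c. c) antipode_gen"

primrec star_gen :: "qgen \<Rightarrow> free_alg" where
  "star_gen QK = gen QK"
| "star_gen QKi = gen QKi"
| "star_gen QE = gen QF * gen QK"
| "star_gen QF = gen QKi * gen QE"

definition star :: "free_alg \<Rightarrow> free_alg" where
  "star = anti_ext cnj star_gen"

primrec unitary_antipode_gen :: "real \<Rightarrow> qgen \<Rightarrow> free_alg" where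
  "unitary_antipode_gen q QK = gen QKi"
| "unitary_antipode_gen q QKi = gen QK"
| "unitary_antipode_gen q QE = - (cst (of_real q) * gen QKi * gen QE)"
| "unitary_antipode_gen q QF = - (cst (of_real (inverse q)) * gen QF * gen QK)"

definition unitary_antipode :: "real \<Rightarrow> free_alg \<Rightarrow> free_alg" where
  "unitary_antipode q = anti_ext (\<lambda>c. c) (unitary_antipode_gen q)"


section \<open>Spin representations and $\mathcal{O}_q(SU(2))$\<close>

text \<open>
  The spin \<open>s\<close> is a real number in \<open>{n/2 | n :: nat}\<close>; vectors of \<open>H\<^sub>s\<close> are functions of the
  (half-integral, real) index \<open>j\<close> that vanish off \<open>{-s, -s+1, \<dots>, s}\<close>.
\<close>

definition spin_index :: "real \<Rightarrow> real set" where
  "spin_index s = {- s + real n | n. real n \<le> 2 * s}"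

definition spin_space :: "real \<Rightarrow> (real \<Rightarrow> complex) set" where
  "spin_space s = {\<xi>. \<forall>j. j \<notin> spin_index s \<longrightarrow> \<xi> j = 0}"

definition spin_inner :: "real \<Rightarrow> (real \<Rightarrow> complex) \<Rightarrow> (real \<Rightarrow> complex) \<Rightarrow> complex" where
  "spin_inner s \<xi> \<eta> = (\<Sum>j\<in>spin_index s. cnj (\<xi> j) * \<eta> j)"

definition spin_basis :: "real \<Rightarrow> real \<Rightarrow> complex" where
  "spin_basis j = (\<lambda>i. if i = j then 1 else 0)"

definition fscale :: "complex \<Rightarrow> ('x \<Rightarrow> complex) \<Rightarrow> 'x \<Rightarrow> complex" where
  "fscale c x = (\<lambda>h. c * x h)"

primrec spin_gen :: "real \<Rightarrow> real \<Rightarrow> qgen \<Rightarrow> real \<Rightarrow> (real \<Rightarrow> complex)" where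
  "spin_gen q s QK j = fscale (of_real (q powr (2 * j))) (spin_basis j)"
| "spin_gen q s QKi j = fscale (of_real (q powr (- (2 * j)))) (spin_basis j)"
| "spin_gen q s QE j =
     fscale (of_real (q powr (j + 1) * sqrt (qnum q (s - j) * qnum q (s + j + 1))))
       (spin_basis (j + 1))"
| "spin_gen q s QF j =
     fscale (of_real (q powr (- j) * sqrt (qnum q (s + j) * qnum q (s - j + 1))))
       (spin_basis (j - 1))"

definition spin_op :: "real \<Rightarrow> real \<Rightarrow> qgen \<Rightarrow> (real \<Rightarrow> complex) \<Rightarrow> (real \<Rightarrow> complex)" where
  "spin_op q s g \<eta> = (\<Sum>j\<in>spin_index s. fscale (\<eta> j) (spin_gen q s g j))"

definition spin_rep :: "real \<Rightarrow> real \<Rightarrow> free_alg \<Rightarrow> (real \<Rightarrow> complex) \<Rightarrow> (real \<Rightarrow> complex)" where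
  "spin_rep q s h \<eta> = (\<Sum>w\<in>Poly_Mapping.keys h.
     fscale (Poly_Mapping.lookup h w) (foldr (spin_op q s) w \<eta>))"

text \<open>
  Functionals on \<open>U\<^sub>q\<close> are identified with functionals on the free algebra that vanish on
  \<open>uq_ideal q\<close>; the matrix coefficients below do so.
\<close>

type_synonym dual = "free_alg \<Rightarrow> complex"

definition matcoef :: "real \<Rightarrow> real \<Rightarrow> (real \<Rightarrow> complex) \<Rightarrow> (real \<Rightarrow> complex) \<Rightarrow> dual" where
  "matcoef q s \<xi> \<eta> = (\<lambda>h. spin_inner s \<xi> (spin_rep q s h \<eta>))"

definition Oq_SU2 :: "real \<Rightarrow> dual set" where
  "Oq_SU2 q = Modules.module.span fscale
     {matcoef q (real n / 2) \<xi> \<eta> | n \<xi> \<eta>. \<xi> \<in> spin_space (real n / 2) \<and> \<eta> \<in> spin_space (real n / 2)}"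

text \<open>
  The product of \<open>\<A>\<close>, dual to \<open>\<Delta>\<close>; its unit is \<^const>\<open>counit\<close>.  The pointwise product that
  \<^theory>\<open>HOL-Library.Function_Algebras\<close> puts on functions is never used for functionals.
\<close>

definition dual_mult :: "dual \<Rightarrow> dual \<Rightarrow> dual" where
  "dual_mult x y = (\<lambda>h. \<Sum>(v, w)\<in>Poly_Mapping.keys (Delta h).
     Poly_Mapping.lookup (Delta h) (v, w)
       * x (Poly_Mapping.single v 1) * y (Poly_Mapping.single w 1))"

definition dual_star :: "dual \<Rightarrow> dual" where
  "dual_star x = (\<lambda>h. cnj (x (star (antipode h))))"

definition dual_counit :: "dual \<Rightarrow> complex" where
  "dual_counit x = x 1"

text \<open>
  As the coproduct of \<open>\<A>\<close> is dual to the product of \<open>U\<^sub>q\<close>, the functionals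
  \<open>h \<rhd> x = x\<^sub>(\<^sub>1\<^sub>) (x\<^sub>(\<^sub>2\<^sub>), h)\<close> and \<open>x \<lhd> h = (x\<^sub>(\<^sub>1\<^sub>), h) x\<^sub>(\<^sub>2\<^sub>)\<close> are \<open>g \<mapsto> x (g h)\<close> and \<open>g \<mapsto> x (h g)\<close>.
\<close>

definition left_act :: "free_alg \<Rightarrow> dual \<Rightarrow> dual" where
  "left_act h x = (\<lambda>g. x (g * h))"

definition right_act :: "dual \<Rightarrow> free_alg \<Rightarrow> dual" where
  "right_act x h = (\<lambda>g. x (h * g))"


section \<open>The coideal $I$ and the Podles sphere\<close>

definition t_par :: "real \<Rightarrow> real \<Rightarrow> real" where
  "t_par q a = q powr a - q powr (- a)"

definition B_t :: "real \<Rightarrow> real \<Rightarrow> free_alg" where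
  "B_t q a = cst (of_real (q powr (- 1 / 2))) * (gen QE - gen QF * gen QK)
     - cst (\<i> * of_real (inverse (q - inverse q) * t_par q a)) * gen QK"

definition RB_t :: "real \<Rightarrow> real \<Rightarrow> free_alg" where
  "RB_t q a = unitary_antipode q (B_t q a)"

text \<open>All representatives in the free algebra of elements of \<open>I = \<complex>[R(B\<^sub>t)]\<close>.\<close>

definition I_coideal :: "real \<Rightarrow> real \<Rightarrow> free_alg set" where
  "I_coideal q a = {h. \<exists>n c. h - (\<Sum>i\<le>n. cst (c i) * RB_t q a ^ i) \<in> uq_ideal q}"

definition podles :: "real \<Rightarrow> real \<Rightarrow> dual set" where
  "podles q a = {x \<in> Oq_SU2 q. left_act (RB_t q a) x = fscale (counit (B_t q a)) x}"

text \<open>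
  A unit eigenvector \<open>\<eta>\<^sup>1\<^bsub>[a]\<^esub>\<close> of \<open>\<pi>\<^sub>1(iR(B\<^sub>t))\<close>; it is unique up to a phase, which does not affect
  \<open>u\<^sup>1\<^bsub>[a],[a]\<^esub>\<close>.
\<close>

definition is_eta1 :: "real \<Rightarrow> real \<Rightarrow> (real \<Rightarrow> complex) \<Rightarrow> bool" where
  "is_eta1 q a \<eta> \<longleftrightarrow> \<eta> \<in> spin_space 1 \<and> spin_inner 1 \<eta> \<eta> = 1 \<and>
     spin_rep q 1 (cst \<i> * RB_t q a) \<eta> = fscale (of_real (qnum q a)) \<eta>"

definition u1 :: "real \<Rightarrow> (real \<Rightarrow> complex) \<Rightarrow> dual" where
  "u1 q \<eta> = matcoef q 1 \<eta> \<eta>"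


section \<open>Complex vector spaces and pre-Hilbert spaces\<close>

definition complex_ring :: "complex ring" where
  "complex_ring = \<lparr>carrier = UNIV, mult = (*), one = 1, zero = 0, add = (+)\<rparr>"

text \<open>
  Vector spaces are \<^locale>\<open>module\<close>s over \<^const>\<open>complex_ring\<close>.  The \<open>mult\<close> and \<open>one\<close> fields that the
  record type inherits from rings play no role there and are left undefined.
\<close>

record 'v prehilbert = "(complex, 'v) module" +
  inner_prod :: "'v \<Rightarrow> 'v \<Rightarrow> complex"

locale prehilbert_space = module complex_ring H for H :: "('v, 'x) prehilbert_scheme" (structure) +
  assumes inner_add: "\<lbrakk>u \<in> carrier H; v \<in> carrier H; w \<in> carrier H\<rbrakk> \<Longrightarrow>
      inner_prod H u (v \<oplus> w) = inner_prod H u v + inner_prod H u w"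
    and inner_smult: "\<lbrakk>u \<in> carrier H; v \<in> carrier H\<rbrakk> \<Longrightarrow>
      inner_prod H u (c \<odot> v) = c * inner_prod H u v"
    and inner_commute: "\<lbrakk>u \<in> carrier H; v \<in> carrier H\<rbrakk> \<Longrightarrow>
      inner_prod H v u = cnj (inner_prod H u v)"
    and inner_pos: "\<lbrakk>v \<in> carrier H; v \<noteq> \<zero>\<rbrakk> \<Longrightarrow> 0 < Re (inner_prod H v v)"

definition linear_map_on ::
  "(complex, 'v, 'x) module_scheme \<Rightarrow> (complex, 'w, 'y) module_scheme \<Rightarrow> ('v \<Rightarrow> 'w) \<Rightarrow> bool" where
  "linear_map_on V W T \<longleftrightarrow>
     T \<in> carrier V \<rightarrow> carrier W \<and>
     (\<forall>v\<in>carrier V. \<forall>w\<in>carrier V. T (v \<oplus>\<^bsub>V\<^esub> w) = T v \<oplus>\<^bsub>W\<^esub> T w) \<and>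
     (\<forall>c. \<forall>v\<in>carrier V. T (c \<odot>\<^bsub>V\<^esub> v) = c \<odot>\<^bsub>W\<^esub> T v)"

definition unitary_operator ::
  "('v, 'x) prehilbert_scheme \<Rightarrow> ('w, 'y) prehilbert_scheme \<Rightarrow> ('v \<Rightarrow> 'w) \<Rightarrow> bool" where
  "unitary_operator H K U \<longleftrightarrow>
     prehilbert_space H \<and> prehilbert_space K \<and> linear_map_on H K U \<and>
     U ` carrier H = carrier K \<and>
     (\<forall>v\<in>carrier H. \<forall>w\<in>carrier H. inner_prod K (U v) (U w) = inner_prod H v w)"


section \<open>Modules and admissible $*$-representations of $\mathcal{B} \bowtie I$\<close>

text \<open>
  Unital representation on \<open>V\<close> of an algebra with underlying set \<open>X\<close>, scalar multiplication \<open>sc\<close>,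
  product \<open>mul\<close> and unit \<open>e\<close>.
\<close>

definition algebra_rep ::
  "'x::ab_group_add set \<Rightarrow> (complex \<Rightarrow> 'x \<Rightarrow> 'x) \<Rightarrow> ('x \<Rightarrow> 'x \<Rightarrow> 'x) \<Rightarrow> 'x \<Rightarrow>
   (complex, 'v, 'r) module_scheme \<Rightarrow> ('x \<Rightarrow> 'v \<Rightarrow> 'v) \<Rightarrow> bool" where
  "algebra_rep X sc mul e V \<phi> \<longleftrightarrow>
     (\<forall>x\<in>X. linear_map_on V V (\<phi> x)) \<and>
     (\<forall>x\<in>X. \<forall>y\<in>X. \<forall>v\<in>carrier V. \<phi> (x + y) v = \<phi> x v \<oplus>\<^bsub>V\<^esub> \<phi> y v) \<and>
     (\<forall>c. \<forall>x\<in>X. \<forall>v\<in>carrier V. \<phi> (sc c x) v = c \<odot>\<^bsub>V\<^esub> \<phi> x v) \<and>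
     (\<forall>x\<in>X. \<forall>y\<in>X. \<forall>v\<in>carrier V. \<phi> (mul x y) v = \<phi> x (\<phi> y v)) \<and>
     (\<forall>v\<in>carrier V. \<phi> e v = v)"

text \<open>
  A module of \<open>\<B> \<bowtie> I\<close>: actions \<open>\<pi>\<close> of \<open>\<B>\<close> and \<open>\<rho>\<close> of \<open>I\<close> with \<open>b h = h\<^sub>(\<^sub>1\<^sub>) (b \<lhd> h\<^sub>(\<^sub>2\<^sub>))\<close>.
  The last clause states this for every way of writing
  \<open>\<Delta>(h) = \<Sum>\<^sub>i h\<^sub>1 i \<otimes> h\<^sub>2 i\<close> in \<open>I \<otimes> U\<^sub>q\<close>.
\<close>

definition double_module ::
  "real \<Rightarrow> real \<Rightarrow> (complex, 'v, 'r) module_scheme \<Rightarrow> (dual \<Rightarrow> 'v \<Rightarrow> 'v) \<Rightarrow> (free_alg \<Rightarrow> 'v \<Rightarrow> 'v) \<Rightarrow> bool"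
  where
  "double_module q a V \<pi> \<rho> \<longleftrightarrow>
     module complex_ring V \<and>
     algebra_rep (podles q a) fscale dual_mult counit V \<pi> \<and>
     algebra_rep (I_coideal q a) (\<lambda>c h. cst c * h) (*) 1 V \<rho> \<and>
     (\<forall>h\<in>uq_ideal q. \<forall>v\<in>carrier V. \<rho> h v = \<zero>\<^bsub>V\<^esub>) \<and>
     (\<forall>b\<in>podles q a. \<forall>h\<in>I_coideal q a. \<forall>(n::nat) h1 h2.
        (\<forall>i<n. h1 i \<in> I_coideal q a) \<longrightarrow>
        Delta h - (\<Sum>i<n. tens (h1 i) (h2 i)) \<in> uq_ideal2 q \<longrightarrow>
        (\<forall>v\<in>carrier V. \<pi> b (\<rho> h v) =
           (\<Oplus>\<^bsub>V\<^esub>i\<in>{..<n}. \<rho> (h1 i) (\<pi> (right_act b (h2 i)) v))))"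

text \<open>Vectors of weight \<open>\<mu>\<close>, i.e. the eigenspace of \<open>iR(B\<^sub>t)\<close> (including \<open>0\<close>).\<close>

definition weight_space ::
  "real \<Rightarrow> real \<Rightarrow> (complex, 'v, 'r) module_scheme \<Rightarrow> (free_alg \<Rightarrow> 'v \<Rightarrow> 'v) \<Rightarrow> real \<Rightarrow> 'v set" where
  "weight_space q a V \<rho> \<mu> =
     {v \<in> carrier V. \<rho> (cst \<i> * RB_t q a) v = of_real \<mu> \<odot>\<^bsub>V\<^esub> v}"

definition diagonalizable_with ::
  "real \<Rightarrow> real \<Rightarrow> (complex, 'v, 'r) module_scheme \<Rightarrow> (free_alg \<Rightarrow> 'v \<Rightarrow> 'v) \<Rightarrow> real set \<Rightarrow> bool" where
  "diagonalizable_with q a V \<rho> W \<longleftrightarrow>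
     (\<forall>v\<in>carrier V. \<exists>A w. finite A \<and> A \<subseteq> W \<and> (\<forall>\<mu>\<in>A. w \<mu> \<in> weight_space q a V \<rho> \<mu>) \<and>
        v = (\<Oplus>\<^bsub>V\<^esub>\<mu>\<in>A. w \<mu>))"

definition finite_dim_in :: "(complex, 'v, 'r) module_scheme \<Rightarrow> 'v set \<Rightarrow> bool" where
  "finite_dim_in V X \<longleftrightarrow>
     (\<exists>S. finite S \<and> S \<subseteq> X \<and> (\<forall>v\<in>X. \<exists>c. v = (\<Oplus>\<^bsub>V\<^esub>s\<in>S. c s \<odot>\<^bsub>V\<^esub> s)))"

definition one_dim_in :: "(complex, 'v, 'r) module_scheme \<Rightarrow> 'v set \<Rightarrow> bool" where
  "one_dim_in V X \<longleftrightarrow> (\<exists>v\<in>carrier V. v \<noteq> \<zero>\<^bsub>V\<^esub> \<and> X = {c \<odot>\<^bsub>V\<^esub> v | c. True})"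

definition admissible ::
  "real \<Rightarrow> real \<Rightarrow> ('v, 'r) prehilbert_scheme \<Rightarrow> (dual \<Rightarrow> 'v \<Rightarrow> 'v) \<Rightarrow> (free_alg \<Rightarrow> 'v \<Rightarrow> 'v) \<Rightarrow> bool"
  where
  "admissible q a V \<pi> \<rho> \<longleftrightarrow>
     prehilbert_space V \<and> double_module q a V \<pi> \<rho> \<and>
     (\<forall>b\<in>podles q a. \<forall>v\<in>carrier V. \<forall>w\<in>carrier V.
        inner_prod V (\<pi> b v) w = inner_prod V v (\<pi> (dual_star b) w)) \<and>
     (\<forall>h\<in>I_coideal q a. \<forall>v\<in>carrier V. \<forall>w\<in>carrier V.
        inner_prod V (\<rho> h v) w = inner_prod V v (\<rho> (star h) w)) \<and>
     diagonalizable_with q a V \<rho> (range (\<lambda>n::int. qnum q (a + of_int n))) \<and>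
     (\<forall>n::int. finite_dim_in V (weight_space q a V \<rho> (qnum q (a + of_int n))))"

definition invariant_subspace ::
  "real \<Rightarrow> real \<Rightarrow> (complex, 'v, 'r) module_scheme \<Rightarrow> (dual \<Rightarrow> 'v \<Rightarrow> 'v) \<Rightarrow> (free_alg \<Rightarrow> 'v \<Rightarrow> 'v) \<Rightarrow>
   'v set \<Rightarrow> bool" where
  "invariant_subspace q a V \<pi> \<rho> W \<longleftrightarrow>
     submodule W complex_ring V \<and>
     (\<forall>b\<in>podles q a. \<pi> b ` W \<subseteq> W) \<and> (\<forall>h\<in>I_coideal q a. \<rho> h ` W \<subseteq> W)"

definition irreducible_rep ::
  "real \<Rightarrow> real \<Rightarrow> (complex, 'v, 'r) module_scheme \<Rightarrow> (dual \<Rightarrow> 'v \<Rightarrow> 'v) \<Rightarrow> (free_alg \<Rightarrow> 'v \<Rightarrow> 'v) \<Rightarrow> bool"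
  where
  "irreducible_rep q a V \<pi> \<rho> \<longleftrightarrow>
     carrier V \<noteq> {\<zero>\<^bsub>V\<^esub>} \<and>
     (\<forall>W. invariant_subspace q a V \<pi> \<rho> W \<longrightarrow> W = {\<zero>\<^bsub>V\<^esub>} \<or> W = carrier V)"

text \<open>
  \<open>(V, \<pi>, \<rho>)\<close> is (a realization of) \<open>\<L>\<^sup>+\<^sub>\<lambda>\<close> for \<open>\<lambda> = l\<close>, and \<open>e\<close> is its unit vector \<open>e\<^sub>a\<^sup>\<lambda>\<close>.
\<close>

definition is_L_plus ::
  "real \<Rightarrow> real \<Rightarrow> (real \<Rightarrow> complex) \<Rightarrow> real \<Rightarrow> ('v, 'r) prehilbert_scheme \<Rightarrow>
   (dual \<Rightarrow> 'v \<Rightarrow> 'v) \<Rightarrow> (free_alg \<Rightarrow> 'v \<Rightarrow> 'v) \<Rightarrow> 'v \<Rightarrow> bool" where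
  "is_L_plus q a \<eta> l V \<pi> \<rho> e \<longleftrightarrow>
     admissible q a V \<pi> \<rho> \<and> irreducible_rep q a V \<pi> \<rho> \<and>
     diagonalizable_with q a V \<rho> (range (\<lambda>n::int. qnum q (a + 2 * of_int n))) \<and>
     (\<forall>n::int. one_dim_in V (weight_space q a V \<rho> (qnum q (a + 2 * of_int n)))) \<and>
     e \<in> weight_space q a V \<rho> (qnum q a) \<and> inner_prod V e e = 1 \<and>
     (let d = q + inverse q; t = t_par q a in
        \<pi> (u1 q \<eta>) e = of_real ((l + inverse d * t\<^sup>2) / (d + inverse d * t\<^sup>2)) \<odot>\<^bsub>V\<^esub> e)"

definition double_hom ::
  "real \<Rightarrow> real \<Rightarrow> (complex, 'v, 'r) module_scheme \<Rightarrow> (dual \<Rightarrow> 'v \<Rightarrow> 'v) \<Rightarrow> (free_alg \<Rightarrow> 'v \<Rightarrow> 'v) \<Rightarrow>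
   (complex, 'w, 's) module_scheme \<Rightarrow> (dual \<Rightarrow> 'w \<Rightarrow> 'w) \<Rightarrow> (free_alg \<Rightarrow> 'w \<Rightarrow> 'w) \<Rightarrow>
   ('v \<Rightarrow> 'w) \<Rightarrow> bool" where
  "double_hom q a V \<pi> \<rho> W \<pi>' \<rho>' T \<longleftrightarrow>
     linear_map_on V W T \<and>
     (\<forall>b\<in>podles q a. \<forall>v\<in>carrier V. T (\<pi> b v) = \<pi>' b (T v)) \<and>
     (\<forall>h\<in>I_coideal q a. \<forall>v\<in>carrier V. T (\<rho> h v) = \<rho>' h (T v))"

definition spherical_vector ::
  "real \<Rightarrow> real \<Rightarrow> (real \<Rightarrow> complex) \<Rightarrow> (complex, 'v, 'r) module_scheme \<Rightarrow>
   (dual \<Rightarrow> 'v \<Rightarrow> 'v) \<Rightarrow> (free_alg \<Rightarrow> 'v \<Rightarrow> 'v) \<Rightarrow> 'v \<Rightarrow> bool" where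
  "spherical_vector q a \<eta> V \<pi> \<rho> e \<longleftrightarrow>
     double_module q a V \<pi> \<rho> \<and> e \<in> weight_space q a V \<rho> (qnum q a) \<and> \<pi> (u1 q \<eta>) e = e"

text \<open>
  \<open>(M, \<pi>, \<rho>, e)\<close> is \<open>\<M>\<^bsub>q+q\<^sup>-\<^sup>1,a\<^esub>\<close> with its generator \<open>e\<^sub>a\<close>.  It suffices to test
  universality on modules with elements of type \<open>dual set\<close>: the submodule generated by a weight
  vector \<open>v\<close> is \<open>\<B> v\<close>, which is in bijection with the cosets in \<open>\<B>\<close> of the annihilator of \<open>v\<close>.
\<close>

definition is_M_univ ::
  "real \<Rightarrow> real \<Rightarrow> (real \<Rightarrow> complex) \<Rightarrow> (complex, 'v, 'r) module_scheme \<Rightarrow>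
   (dual \<Rightarrow> 'v \<Rightarrow> 'v) \<Rightarrow> (free_alg \<Rightarrow> 'v \<Rightarrow> 'v) \<Rightarrow> 'v \<Rightarrow> bool" where
  "is_M_univ q a \<eta> M \<pi> \<rho> e \<longleftrightarrow>
     spherical_vector q a \<eta> M \<pi> \<rho> e \<and>
     (\<forall>W. invariant_subspace q a M \<pi> \<rho> W \<and> e \<in> W \<longrightarrow> W = carrier M) \<and>
     (\<forall>(N :: (complex, dual set) module) \<pi>' \<rho>' v. spherical_vector q a \<eta> N \<pi>' \<rho>' v \<longrightarrow>
        (\<exists>T. double_hom q a M \<pi> \<rho> N \<pi>' \<rho>' T \<and> T e = v))"


section \<open>The generating functional $L$ and the cocycles\<close>

definition kappa :: "real \<Rightarrow> real \<Rightarrow> real" where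
  "kappa q a = qbrace q (a + 2) / (qbrace q a * (qbrace q (2 * a + 1) + q + inverse q))"

text \<open>
  In the following, \<open>V l\<close>, \<open>\<pi> l\<close>, \<open>e l\<close> are the space, the action of \<open>\<B>\<close> and the unit vector of
  \<open>\<L>\<^sup>+\<^sub>\<lambda>\<close> for \<open>\<lambda> = l\<close>.
\<close>

definition omega ::
  "(real \<Rightarrow> ('v, 'r) prehilbert_scheme) \<Rightarrow> (real \<Rightarrow> dual \<Rightarrow> 'v \<Rightarrow> 'v) \<Rightarrow> (real \<Rightarrow> 'v) \<Rightarrow>
   real \<Rightarrow> dual \<Rightarrow> complex" where
  "omega V \<pi> e l b = inner_prod (V l) (e l) (\<pi> l b (e l))"

definition gen_functional ::
  "real \<Rightarrow> real \<Rightarrow> (real \<Rightarrow> ('v, 'r) prehilbert_scheme) \<Rightarrow> (real \<Rightarrow> dual \<Rightarrow> 'v \<Rightarrow> 'v) \<Rightarrow>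
   (real \<Rightarrow> 'v) \<Rightarrow> dual \<Rightarrow> complex" where
  "gen_functional q a V \<pi> e b =
     of_real (kappa q a) *
     Lim (at_left (q + inverse q))
       (\<lambda>l. (omega V \<pi> e l b - dual_counit b) / of_real (q + inverse q - l))"

definition centre :: "dual \<Rightarrow> dual" where
  "centre x = x - fscale (dual_counit x) counit"

text \<open>
  The objects \<open>\<langle>\<cdot>,\<cdot>\<rangle>\<^sub>L\<close>, \<open>N\<^sub>L\<close>, \<open>C\<^sub>L\<close> and \<open>\<H>\<^sub>L = \<B>/N\<^sub>L\<close> attached to a functional \<open>L\<close> on
  a set \<open>B\<close> of functionals; elements of \<open>\<H>\<^sub>L\<close> are cosets.
\<close>

definition form_L :: "(dual \<Rightarrow> complex) \<Rightarrow> dual \<Rightarrow> dual \<Rightarrow> complex" where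
  "form_L L x y = L (dual_mult (dual_star (centre x)) (centre y))"

definition null_L :: "dual set \<Rightarrow> (dual \<Rightarrow> complex) \<Rightarrow> dual set" where
  "null_L B L = {x \<in> B. form_L L x x = 0}"

definition C_L :: "dual set \<Rightarrow> (dual \<Rightarrow> complex) \<Rightarrow> dual \<Rightarrow> dual set" where
  "C_L B L x = {y \<in> B. y - x \<in> null_L B L}"

definition H_L :: "dual set \<Rightarrow> (dual \<Rightarrow> complex) \<Rightarrow> dual set prehilbert" where
  "H_L B L =
     \<lparr>carrier = C_L B L ` B, mult = undefined, one = undefined,
      zero = C_L B L 0,
      add = (\<lambda>X Y. \<Union>x\<in>X. \<Union>y\<in>Y. C_L B L (x + y)),
      smult = (\<lambda>c X. \<Union>x\<in>X. C_L B L (fscale c x)),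
      inner_prod = (\<lambda>X Y. the_elem (\<Union>x\<in>X. \<Union>y\<in>Y. {form_L L x y}))\<rparr>"

text \<open>
  \<open>\<D>\<^sub>2\<^sup>+ \<oplus> \<D>\<^sub>2\<^sup>- = ker(\<epsilon>|\<^sub>\<B>) e\<^sub>a \<subseteq> M\<close>, equipped with the form \<open>f\<close>.
\<close>

definition D2_sum ::
  "real \<Rightarrow> real \<Rightarrow> (complex, 'v, 'r) module_scheme \<Rightarrow> (dual \<Rightarrow> 'v \<Rightarrow> 'v) \<Rightarrow> 'v \<Rightarrow>
   ('v \<Rightarrow> 'v \<Rightarrow> complex) \<Rightarrow> 'v prehilbert" where
  "D2_sum q a M \<pi> e f =
     \<lparr>carrier = {\<pi> b e | b. b \<in> podles q a \<and> dual_counit b = 0}, mult = undefined, one = undefined,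
      zero = \<zero>\<^bsub>M\<^esub>, add = add M, smult = smult M, inner_prod = f\<rparr>"

definition cocycle ::
  "(complex, 'v, 'r) module_scheme \<Rightarrow> (dual \<Rightarrow> 'v \<Rightarrow> 'v) \<Rightarrow> 'v \<Rightarrow> dual \<Rightarrow> 'v" where
  "cocycle M \<pi> e b = \<pi> b e \<ominus>\<^bsub>M\<^esub> dual_counit b \<odot>\<^bsub>M\<^esub> e"

text \<open>
  \<open>f\<close> is the invariant inner product on \<open>\<D>\<^sub>2\<^sup>+ \<oplus> \<D>\<^sub>2\<^sup>-\<close>, where \<open>M\<close>, \<open>\<pi>M\<close>, \<open>eM\<close> are the space,
  the action of \<open>\<B>\<close> and the generator of \<open>\<M>\<^bsub>q+q\<^sup>-\<^sup>1,a\<^esub>\<close>.  As \<open>C\<close> maps \<open>\<B>\<close> onto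
  \<open>\<D>\<^sub>2\<^sup>+ \<oplus> \<D>\<^sub>2\<^sup>-\<close>, the limits determine \<open>f\<close> there.
\<close>

definition is_D2_inner ::
  "real \<Rightarrow> real \<Rightarrow> (real \<Rightarrow> ('v, 'r) prehilbert_scheme) \<Rightarrow> (real \<Rightarrow> dual \<Rightarrow> 'v \<Rightarrow> 'v) \<Rightarrow> (real \<Rightarrow> 'v) \<Rightarrow>
   (complex, 'w, 's) module_scheme \<Rightarrow> (dual \<Rightarrow> 'w \<Rightarrow> 'w) \<Rightarrow> 'w \<Rightarrow> ('w \<Rightarrow> 'w \<Rightarrow> complex) \<Rightarrow> bool" where
  "is_D2_inner q a V \<pi> e M \<pi>M eM f \<longleftrightarrow>
     prehilbert_space (D2_sum q a M \<pi>M eM f) \<and>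
     (\<forall>x\<in>podles q a. \<forall>y\<in>podles q a.
        ((\<lambda>l. of_real (kappa q a) *
            inner_prod (V l) (cocycle (V l) (\<pi> l) (e l) x) (cocycle (V l) (\<pi> l) (e l) y)
            / of_real (q + inverse q - l))
         \<longlongrightarrow> f (cocycle M \<pi>M eM x) (cocycle M \<pi>M eM y)) (at_left (q + inverse q)))"

end

theory Submission
  imports Defs
begin

text \<open>
  Both inner products are the same limit.  Write \<open>x\<^sub>0 = x - \<epsilon>(x) 1\<close>.  In \<open>\<L>\<^sup>+\<^sub>\<lambda>\<close> the cocycle vector
  \<open>\<pi>\<^sub>\<lambda>(x) e - \<epsilon>(x) e\<close> is \<open>\<pi>\<^sub>\<lambda>(x\<^sub>0) e\<close>, so, \<open>\<pi>\<^sub>\<lambda>\<close> being a $*$-representation,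
  \<open>\<langle>\<pi>\<^sub>\<lambda>(x\<^sub>0) e, \<pi>\<^sub>\<lambda>(y\<^sub>0) e\<rangle> = \<omega>\<^sub>\<lambda>(x\<^sub>0\<^sup>* y\<^sub>0)\<close>.  As \<open>\<epsilon>(x\<^sub>0\<^sup>* y\<^sub>0) = 0\<close>, multiplying by \<open>\<kappa>\<close>, dividing by
  \<open>q + q\<^sup>-\<^sup>1 - \<lambda>\<close> and letting \<open>\<lambda>\<close> tend to \<open>q + q\<^sup>-\<^sup>1\<close> gives \<open>\<langle>x, y\<rangle>\<^sub>L\<close> on one side
  and \<open>\<langle>C(x), C(y)\<rangle>\<close> on the other (\<open>form_L_eq_limit\<close>).  Hence \<open>N\<^sub>L\<close> is the kernel of the surjection \<open>C\<close>, and \<open>C\<close>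
  factors through a unitary \<open>U\<close>; this is the uniqueness part of the GNS construction (\<open>gns_uniqueness\<close>).

  The point that needs work is that \<open>x\<^sub>0\<^sup>*\<close> acts at all, that is, that the sphere \<open>\<B>\<close> contains
  the unit and is closed under the involution (\<open>dual_star_in_podles\<close>).  Closure has two parts.  The conjugate of
  a spin representation along \<open>h \<mapsto> S(h)\<^sup>*\<close> is equivalent to that representation, through the
  antilinear map \<open>\<xi>\<^sub>j \<mapsto> \<plusminus> q\<^sup>-\<^sup>j \<xi>\<^sub>-\<^sub>j\<close>, so the involution preserves the span of the matrix
  coefficients (\<open>dual_star_in_Oq_SU2\<close>).  And the relation \<open>S(R(B\<^sub>t))\<^sup>* = k R(B\<^sub>t) - \<epsilon>(B\<^sub>t)(1 + k)\<close>
  shows that it preserves the eigenvalue condition that cuts \<open>\<B>\<close> out of \<open>\<A>\<close>.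
\<close>


section \<open>Linear extensions from words to the free algebra\<close>

lemma free_monomial_induct [case_names zero monomial add]:
  fixes P :: "('w \<Rightarrow>\<^sub>0 'c::comm_monoid_add) \<Rightarrow> bool"
  assumes zero: "P 0" and single: "\<And>w c. P (Poly_Mapping.single w c)"
    and add: "\<And>x y. P x \<Longrightarrow> P y \<Longrightarrow> P (x + y)"
  shows "P x"
proof (induction x rule: update_induct)
  case const
  show ?case by (rule zero)
next
  case (update x w c)
  have "Poly_Mapping.update w c x = x + Poly_Mapping.single w c"
    using update.hyps(1)
    by (intro poly_mapping_eqI) (auto simp: lookup_update lookup_add lookup_single in_keys_iff when_def)
  then show ?case using add[OF update.IH single] by simp
qed

lemma cst_commute: "cst c * (x :: 'w::monoid_add \<Rightarrow>\<^sub>0 complex) = x * cst c"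
  by (induction x rule: free_monomial_induct)
     (simp_all add: cst_def mult_single mult.commute distrib_left distrib_right)

lemma single_Cons: "Poly_Mapping.single (g # w) (c :: complex) = gen g * Poly_Mapping.single w c"
  by (simp add: gen_def mult_single plus_list_def)

lemma single_Nil: "Poly_Mapping.single ([] :: 'x list) c = cst c"
  by (simp add: cst_def zero_list_def)

lemma cst_cst: "cst c * cst d = (cst (c * d) :: free_alg)"
  by (simp add: cst_def mult_single)

lemma cst_one [simp]: "cst 1 = 1" by (simp add: cst_def)

text \<open>
  The antipode, the involution and the unitary antipode are all of the form \<open>anti_ext \<sigma> \<phi>\<close>, with \<open>\<sigma>\<close> the
  identity or complex conjugation.  They reverse products because scalars are central and \<open>\<sigma>\<close> is an
  endomorphism of the field.
\<close>

locale anti_extension =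
  fixes \<sigma> :: "complex \<Rightarrow> complex" and \<phi> :: "qgen \<Rightarrow> free_alg"
  assumes coeff_add: "\<sigma> (c + d) = \<sigma> c + \<sigma> d"
    and coeff_mult: "\<sigma> (c * d) = \<sigma> c * \<sigma> d"
    and coeff_one: "\<sigma> 1 = 1"
begin

lemma coeff_zero: "\<sigma> 0 = 0"
  using coeff_add[of 0 0] by simp

lemma ext_add: "anti_ext \<sigma> \<phi> (x + y) = anti_ext \<sigma> \<phi> x + anti_ext \<sigma> \<phi> y"
  unfolding anti_ext_def
  by (rule setsum_keys_plus_distrib)
     (simp_all add: coeff_zero coeff_add cst_def single_add distrib_right)

lemma ext_diff: "anti_ext \<sigma> \<phi> (x - y) = anti_ext \<sigma> \<phi> x - anti_ext \<sigma> \<phi> y"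
  using ext_add[of "x - y" y] by (simp add: algebra_simps)

lemma ext_uminus: "anti_ext \<sigma> \<phi> (- x) = - anti_ext \<sigma> \<phi> x"
  using ext_diff[of x x] ext_diff[of 0 x] ext_diff[of "0 - x" "0 - x"] by (simp add: ext_diff)

lemma ext_single:
  "anti_ext \<sigma> \<phi> (Poly_Mapping.single w c) = cst (\<sigma> c) * prod_list (rev (map \<phi> w))"
  by (cases "c = 0") (simp_all add: anti_ext_def coeff_zero cst_def)

lemma ext_cst: "anti_ext \<sigma> \<phi> (cst c) = cst (\<sigma> c)"
  by (simp add: ext_single flip: single_Nil)

lemma ext_gen: "anti_ext \<sigma> \<phi> (gen g) = \<phi> g"
  by (simp add: gen_def ext_single coeff_one)

lemma ext_one: "anti_ext \<sigma> \<phi> 1 = 1"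
  using ext_cst[of 1] by (simp add: coeff_one)

lemma ext_mult: "anti_ext \<sigma> \<phi> (x * y) = anti_ext \<sigma> \<phi> y * anti_ext \<sigma> \<phi> x"
proof (induction x rule: free_monomial_induct)
  case zero
  show ?case using ext_diff[of 0 0] by simp
next
  case (monomial v c)
  show ?case
  proof (induction y rule: free_monomial_induct)
    case zero
    show ?case using ext_diff[of 0 0] by simp
  next
    case (monomial w d)
    let ?V = "prod_list (rev (map \<phi> v))" and ?W = "prod_list (rev (map \<phi> w))"
    have "anti_ext \<sigma> \<phi> (Poly_Mapping.single v c * Poly_Mapping.single w d)
        = cst (\<sigma> d) * (cst (\<sigma> c) * ?W) * ?V"
      by (simp add: mult_single plus_list_def ext_single coeff_mult cst_cst mult.commute[of "\<sigma> d"]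
        flip: mult.assoc)
    also have "\<dots> = (cst (\<sigma> d) * ?W) * (cst (\<sigma> c) * ?V)"
      by (simp add: cst_commute[of "\<sigma> c" ?W] mult.assoc)
    finally show ?case by (simp add: ext_single)
  next
    case (add x y)
    then show ?case by (simp add: ext_add distrib_left distrib_right)
  qed
next
  case (add x y)
  then show ?case by (simp add: ext_add distrib_left distrib_right)
qed

lemmas ext_simps = ext_add ext_diff ext_uminus ext_cst ext_gen ext_one ext_mult

end

interpretation S: anti_extension "\<lambda>c. c" antipode_gen
  rewrites "anti_ext (\<lambda>c. c) antipode_gen = antipode"
  by unfold_locales (simp_all add: antipode_def)

interpretation star: anti_extension cnj star_gen
  rewrites "anti_ext cnj star_gen = star"
  by unfold_locales (simp_all add: star_def)

interpretation R: anti_extension "\<lambda>c. c" "unitary_antipode_gen q"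
  rewrites "anti_ext (\<lambda>c. c) (unitary_antipode_gen q) = unitary_antipode q" for q
  by unfold_locales (simp_all add: unitary_antipode_def)


section \<open>The spin representations\<close>

lemma finite_spin_index [simp]: "finite (spin_index s)"
proof -
  have "finite {n. real n \<le> 2 * s}"
    by (rule finite_subset[of _ "{..nat \<lfloor>2 * s\<rfloor>}"]) (auto simp: le_nat_floor)
  moreover have "spin_index s = (\<lambda>n. - s + real n) ` {n. real n \<le> 2 * s}"
    by (auto simp: spin_index_def)
  ultimately show ?thesis by simp
qed

lemma sum_fun_apply: "sum F A x = (\<Sum>a\<in>A. F a x)"
  by (induction A rule: infinite_finite_induct) simp_all

lemma spin_op_add: "spin_op q s g (\<eta> + \<xi>) = spin_op q s g \<eta> + spin_op q s g \<xi>"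
  by (simp add: spin_op_def fscale_def fun_eq_iff sum_fun_apply distrib_right sum.distrib)

lemma spin_op_diff: "spin_op q s g (\<eta> - \<xi>) = spin_op q s g \<eta> - spin_op q s g \<xi>"
  using spin_op_add[of q s g "\<eta> - \<xi>" \<xi>] by (simp add: algebra_simps)

lemma spin_op_scale: "spin_op q s g (fscale c \<eta>) = fscale c (spin_op q s g \<eta>)"
  by (auto simp: spin_op_def fscale_def fun_eq_iff sum_fun_apply sum_distrib_left mult.assoc)

lemma spin_word_add:
  "foldr (spin_op q s) w (\<eta> + \<xi>) = foldr (spin_op q s) w \<eta> + foldr (spin_op q s) w \<xi>"
  by (induction w) (simp_all add: spin_op_add del: plus_fun_apply)

lemma spin_word_scale: "foldr (spin_op q s) w (fscale c \<eta>) = fscale c (foldr (spin_op q s) w \<eta>)"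
  by (induction w) (simp_all add: spin_op_scale)

lemma fscale_0 [simp]: "fscale 0 x = 0" and fscale_1 [simp]: "fscale 1 x = x"
  and fscale_fscale: "fscale c (fscale d x) = fscale (c * d) x"
  and fscale_add: "fscale c (x + y) = fscale c x + fscale c y"
  and fscale_add_left: "fscale (c + d) x = fscale c x + fscale d x"
  by (simp_all add: fscale_def fun_eq_iff algebra_simps)

lemma spin_rep_add: "spin_rep q s (x + y) \<eta> = spin_rep q s x \<eta> + spin_rep q s y \<eta>"
  unfolding spin_rep_def
  by (rule setsum_keys_plus_distrib) (simp_all add: fscale_add_left del: plus_fun_apply zero_fun_apply)

lemma spin_rep_diff: "spin_rep q s (x - y) \<eta> = spin_rep q s x \<eta> - spin_rep q s y \<eta>"
  using spin_rep_add[of q s "x - y" y \<eta>] by (simp add: algebra_simps)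

lemma spin_rep_zero [simp]: "spin_rep q s 0 \<eta> = 0"
  by (simp add: spin_rep_def)

lemma spin_rep_uminus: "spin_rep q s (- x) \<eta> = - spin_rep q s x \<eta>"
  using spin_rep_diff[of q s 0 x \<eta>] by simp

lemma spin_rep_single:
  "spin_rep q s (Poly_Mapping.single w c) \<eta> = fscale c (foldr (spin_op q s) w \<eta>)"
  by (simp add: spin_rep_def)

lemma spin_rep_cst: "spin_rep q s (cst c) \<eta> = fscale c \<eta>"
  by (simp add: spin_rep_single flip: single_Nil)

lemma spin_rep_one: "spin_rep q s 1 \<eta> = \<eta>"
  using spin_rep_cst[of q s 1 \<eta>] by simp

lemma spin_rep_gen: "spin_rep q s (gen g) \<eta> = spin_op q s g \<eta>"
  by (simp add: gen_def spin_rep_single)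

lemma spin_rep_vec_add: "spin_rep q s h (\<eta> + \<xi>) = spin_rep q s h \<eta> + spin_rep q s h \<xi>"
  by (simp add: spin_rep_def spin_word_add fscale_add sum.distrib)

lemma spin_rep_vec_scale: "spin_rep q s h (fscale c \<eta>) = fscale c (spin_rep q s h \<eta>)"
  unfolding spin_rep_def spin_word_scale
  by (simp add: fscale_def fun_eq_iff sum_fun_apply sum_distrib_left mult.left_commute)

lemma spin_rep_mult: "spin_rep q s (x * y) \<eta> = spin_rep q s x (spin_rep q s y \<eta>)"
proof (induction x rule: free_monomial_induct)
  case (monomial v c)
  show ?case
  proof (induction y rule: free_monomial_induct)
    case zero
    show ?case using spin_rep_vec_scale[of q s "Poly_Mapping.single v c" 0 0]
      by (simp del: zero_fun_apply)
  next
    case (monomial w d)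
    show ?case
      by (simp add: mult_single plus_list_def spin_rep_single spin_word_scale fscale_fscale)
  qed (simp add: spin_rep_add spin_rep_vec_add distrib_left del: plus_fun_apply)
qed (simp_all add: spin_rep_add distrib_right del: plus_fun_apply zero_fun_apply)

lemmas spin_rep_simps = spin_rep_add spin_rep_diff spin_rep_uminus spin_rep_cst spin_rep_one
  spin_rep_gen spin_rep_mult

text \<open>
  The ladder operators preserve \<open>H\<^sub>s\<close> only because \<open>[0] = 0\<close> kills them at the two ends of the index
  set, and \<open>-s + \<nat>\<close> reaches the upper end \<open>s\<close> only if \<open>2s\<close> is an integer.
\<close>

definition half_integral :: "real \<Rightarrow> bool" where
  "half_integral s \<longleftrightarrow> (\<exists>n::nat. s = real n / 2)"

lemma spin_index_ladder:
  assumes "half_integral s"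
  shows "j \<in> spin_index s \<Longrightarrow> j + 1 \<in> spin_index s \<or> j = s"
    and "j \<in> spin_index s \<Longrightarrow> j - 1 \<in> spin_index s \<or> j = - s"
    and "- j \<in> spin_index s \<longleftrightarrow> j \<in> spin_index s"
proof -
  obtain n where s: "s = real n / 2" using assms by (auto simp: half_integral_def)
  have mem: "j \<in> spin_index s \<longleftrightarrow> (\<exists>m\<le>n. j = real m - s)" for j
    by (auto simp: spin_index_def s)
  show "j + 1 \<in> spin_index s \<or> j = s" if "j \<in> spin_index s"
  proof -
    obtain m where m: "m \<le> n" "j = real m - s" using \<open>j \<in> spin_index s\<close> mem by auto
    then show ?thesis unfolding mem
      by (cases "m = n") (auto simp: s intro!: exI[of _ "Suc m"])
  qed
  show "j - 1 \<in> spin_index s \<or> j = - s" if "j \<in> spin_index s"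
  proof -
    obtain m where m: "m \<le> n" "j = real m - s" using \<open>j \<in> spin_index s\<close> mem by auto
    then show ?thesis unfolding mem
      by (cases m) auto
  qed
  have "- j \<in> spin_index s" if "j \<in> spin_index s" for j
  proof -
    obtain m where m: "m \<le> n" "j = real m - s" using \<open>j \<in> spin_index s\<close> mem by auto
    then show ?thesis unfolding mem
      by (intro exI[of _ "n - m"]) (auto simp: s of_nat_diff)
  qed
  from this[of j] this[of "- j"] show "- j \<in> spin_index s \<longleftrightarrow> j \<in> spin_index s" by auto
qed

lemma qnum_0 [simp]: "qnum q 0 = 0" by (simp add: qnum_def)

text \<open>
  Read off at a fixed index, the sum over basis vectors has a single term.  A vector of \<open>H\<^sub>s\<close> vanishes off
  the index set, so this term is right
  also when its index lies outside, and identities between operators become identities between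
  coefficients.
\<close>

lemma spin_op_eval:
  assumes "\<eta> \<in> spin_space s"
  shows "spin_op q s QK \<eta> = (\<lambda>i. of_real (q powr (2 * i)) * \<eta> i)"
    and "spin_op q s QKi \<eta> = (\<lambda>i. of_real (q powr (- (2 * i))) * \<eta> i)"
    and "spin_op q s QE \<eta> =
      (\<lambda>i. of_real (q powr i * sqrt (qnum q (s - i + 1) * qnum q (s + i))) * \<eta> (i - 1))"
    and "spin_op q s QF \<eta> =
      (\<lambda>i. of_real (q powr (- i - 1) * sqrt (qnum q (s + i + 1) * qnum q (s - i))) * \<eta> (i + 1))"
proof -
  have off: "\<eta> j = 0" if "j \<notin> spin_index s" for j
    using assms that by (simp add: spin_space_def)
  have val: "spin_op q s g \<eta> i = (\<Sum>j\<in>spin_index s. \<eta> j * spin_gen q s g j i)" for g i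
    by (simp add: spin_op_def fscale_def sum_fun_apply)
  have collapse: "(\<Sum>j\<in>spin_index s. \<eta> j * (c j * (if i = j + d then 1 else 0))) = c (i - d) * \<eta> (i - d)"
    for c :: "real \<Rightarrow> complex" and i d
  proof -
    have "(\<Sum>j\<in>spin_index s. \<eta> j * (c j * (if i = j + d then 1 else 0)))
        = (\<Sum>j\<in>spin_index s. if j = i - d then c j * \<eta> j else 0)"
      by (intro sum.cong) auto
    then show ?thesis using off[of "i - d"] by (simp add: sum.delta)
  qed
  show "spin_op q s QK \<eta> = (\<lambda>i. of_real (q powr (2 * i)) * \<eta> i)"
    using collapse[of "\<lambda>j. of_real (q powr (2 * j))" _ 0]
    by (simp add: fun_eq_iff val fscale_def spin_basis_def)
  show "spin_op q s QKi \<eta> = (\<lambda>i. of_real (q powr (- (2 * i))) * \<eta> i)"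
    using collapse[of "\<lambda>j. of_real (q powr (- (2 * j)))" _ 0]
    by (simp add: fun_eq_iff val fscale_def spin_basis_def)
  show "spin_op q s QE \<eta> =
      (\<lambda>i. of_real (q powr i * sqrt (qnum q (s - i + 1) * qnum q (s + i))) * \<eta> (i - 1))"
    using collapse[of "\<lambda>j. of_real (q powr (j + 1) * sqrt (qnum q (s - j) * qnum q (s + j + 1)))" _ 1]
    by (simp add: fun_eq_iff val fscale_def spin_basis_def algebra_simps)
  show "spin_op q s QF \<eta> =
      (\<lambda>i. of_real (q powr (- i - 1) * sqrt (qnum q (s + i + 1) * qnum q (s - i))) * \<eta> (i + 1))"
    using collapse[of "\<lambda>j. of_real (q powr (- j) * sqrt (qnum q (s + j) * qnum q (s - j + 1)))" _ "- 1"]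
    by (simp add: fun_eq_iff val fscale_def spin_basis_def algebra_simps)
qed

lemma spin_op_in_space:
  assumes "half_integral s" and \<eta>: "\<eta> \<in> spin_space s"
  shows "spin_op q s g \<eta> \<in> spin_space s"
proof -
  have "spin_op q s g \<eta> i = 0" if i: "i \<notin> spin_index s" for i
  proof (cases g)
    case QE
    have "\<eta> (i - 1) = 0 \<or> i = s + 1"
      using spin_index_ladder(1)[OF assms(1), of "i - 1"] i \<eta> by (force simp: spin_space_def)
    then show ?thesis using \<eta> QE by (auto simp: spin_op_eval)
  next
    case QF
    have "\<eta> (i + 1) = 0 \<or> i = - s - 1"
      using spin_index_ladder(2)[OF assms(1), of "i + 1"] i \<eta> by (force simp: spin_space_def)
    then show ?thesis using \<eta> QF by (auto simp: spin_op_eval)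
  qed (use \<eta> i in \<open>auto simp: spin_op_eval spin_space_def\<close>)
  then show ?thesis by (simp add: spin_space_def)
qed

lemma fscale_in_space: "\<eta> \<in> spin_space s \<Longrightarrow> fscale c \<eta> \<in> spin_space s"
  by (simp add: spin_space_def fscale_def)

lemma add_in_space: "\<eta> \<in> spin_space s \<Longrightarrow> \<xi> \<in> spin_space s \<Longrightarrow> \<eta> + \<xi> \<in> spin_space s"
  by (simp add: spin_space_def)

lemma spin_rep_in_space:
  assumes "half_integral s" and "\<eta> \<in> spin_space s"
  shows "spin_rep q s h \<eta> \<in> spin_space s"
proof (induction h rule: free_monomial_induct)
  case zero
  show ?case by (simp add: spin_space_def)
next
  case (monomial w c)
  have "foldr (spin_op q s) w \<eta> \<in> spin_space s"
    using assms by (induction w) (auto intro: spin_op_in_space)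
  then show ?case by (simp add: spin_rep_single fscale_in_space)
qed (simp add: spin_rep_add add_in_space del: plus_fun_apply)

text \<open>
  The elements \<open>S(h)\<^sup>*\<close>, for \<open>h\<close> a generator or \<open>R(B\<^sub>t)\<close>, come out as words with powers of \<open>k\<close> on both
  sides; these relations bring them to normal form.
\<close>

lemma spin_op_relations:
  assumes q: "0 < q" and s: "half_integral s" and \<eta>: "\<eta> \<in> spin_space s"
  shows "spin_op q s QK (spin_op q s QKi \<eta>) = \<eta>"
    and "spin_op q s QKi (spin_op q s QK \<eta>) = \<eta>"
    and "spin_op q s QK (spin_op q s QE \<eta>) = fscale (of_real (q\<^sup>2)) (spin_op q s QE (spin_op q s QK \<eta>))"
    and "spin_op q s QK (spin_op q s QF \<eta>) = fscale (of_real (inverse (q\<^sup>2))) (spin_op q s QF (spin_op q s QK \<eta>))"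
proof -
  have pw: "q\<^sup>2 = q powr 2" "inverse (q\<^sup>2) = q powr (- 2)"
    using q by (simp_all add: powr_minus powr_numeral)
  note sp = spin_op_in_space[OF s \<eta>]
  show "spin_op q s QK (spin_op q s QKi \<eta>) = \<eta>" "spin_op q s QKi (spin_op q s QK \<eta>) = \<eta>"
    unfolding spin_op_eval[OF sp] unfolding spin_op_eval[OF \<eta>]
    using q by (simp_all add: fun_eq_iff powr_minus)
  show "spin_op q s QK (spin_op q s QE \<eta>) = fscale (of_real (q\<^sup>2)) (spin_op q s QE (spin_op q s QK \<eta>))"
    unfolding pw spin_op_eval[OF sp] unfolding spin_op_eval[OF \<eta>] fscale_def
    by (simp add: fun_eq_iff powr_diff powr_add powr_minus q field_simps)
  show "spin_op q s QK (spin_op q s QF \<eta>) = fscale (of_real (inverse (q\<^sup>2))) (spin_op q s QF (spin_op q s QK \<eta>))"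
    unfolding pw spin_op_eval[OF sp] unfolding spin_op_eval[OF \<eta>] fscale_def
    by (simp add: fun_eq_iff powr_diff powr_add powr_minus q field_simps)
qed



section \<open>The matrix coefficients\<close>

interpretation dual: vector_space "fscale :: complex \<Rightarrow> dual \<Rightarrow> dual"
  by unfold_locales (simp_all add: fscale_def fun_eq_iff algebra_simps)

lemma Oq_SU2_closed:
  shows "x \<in> Oq_SU2 q \<Longrightarrow> y \<in> Oq_SU2 q \<Longrightarrow> x + y \<in> Oq_SU2 q"
    and "x \<in> Oq_SU2 q \<Longrightarrow> fscale c x \<in> Oq_SU2 q"
  unfolding Oq_SU2_def by (rule dual.span_add dual.span_scale; assumption)+

lemma matcoef_in_Oq_SU2:
  "half_integral s \<Longrightarrow> \<xi> \<in> spin_space s \<Longrightarrow> \<eta> \<in> spin_space s \<Longrightarrow> matcoef q s \<xi> \<eta> \<in> Oq_SU2 q"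
  unfolding Oq_SU2_def half_integral_def by (rule dual.span_base) blast

lemma Oq_SU2_induct [consumes 1, case_names zero add scale matcoef]:
  assumes "x \<in> Oq_SU2 q" and "P 0" and "\<And>x y. P x \<Longrightarrow> P y \<Longrightarrow> P (x + y)"
    and "\<And>c x. P x \<Longrightarrow> P (fscale c x)"
    and "\<And>s \<xi> \<eta>. half_integral s \<Longrightarrow> \<xi> \<in> spin_space s \<Longrightarrow> \<eta> \<in> spin_space s \<Longrightarrow> P (matcoef q s \<xi> \<eta>)"
  shows "P x"
proof -
  have "dual.subspace {x. P x}"
    using assms(2-4) by (simp add: dual.subspace_def)
  with assms(1) show ?thesis
    unfolding Oq_SU2_def
  proof (rule dual.span_induct)
    fix y
    assume "y \<in> {matcoef q (real n / 2) \<xi> \<eta> | n \<xi> \<eta>.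
      \<xi> \<in> spin_space (real n / 2) \<and> \<eta> \<in> spin_space (real n / 2)}"
    then show "P y" by (auto simp: half_integral_def intro: assms(5))
  qed
qed

lemma spin_inner_linear:
  "spin_inner s \<xi> (\<eta> + \<zeta>) = spin_inner s \<xi> \<eta> + spin_inner s \<xi> \<zeta>"
  "spin_inner s \<xi> (fscale c \<eta>) = c * spin_inner s \<xi> \<eta>"
  by (simp_all add: spin_inner_def fscale_def distrib_left sum.distrib sum_distrib_left mult.left_commute)

lemma Oq_SU2_linear:
  assumes "x \<in> Oq_SU2 q"
  shows "x (g + h) = x g + x h" and "x (cst c * g) = c * x g"
proof -
  have "x (g + h) = x g + x h \<and> x (cst c * g) = c * x g"
    using assms
  proof (induction rule: Oq_SU2_induct)
    case (matcoef s \<xi> \<eta>)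
    then show ?case by (simp add: matcoef_def spin_rep_simps spin_inner_linear del: plus_fun_apply)
  qed (simp_all add: fscale_def algebra_simps)
  then show "x (g + h) = x g + x h" "x (cst c * g) = c * x g" by auto
qed

text \<open>
  Matrix coefficients see an element of the free algebra only through its action on the spin
  representations.  This replaces the passage to the quotient \<open>U\<^sub>q\<close>.
\<close>

lemma Oq_SU2_cong:
  assumes "x \<in> Oq_SU2 q"
    and rel: "\<And>s \<eta>. half_integral s \<Longrightarrow> \<eta> \<in> spin_space s \<Longrightarrow> spin_rep q s r \<eta> = spin_rep q s r' \<eta>"
  shows "x (h * r) = x (h * r')"
  using assms(1)
proof (induction rule: Oq_SU2_induct)
  case (matcoef s \<xi> \<eta>)
  then show ?case by (simp add: matcoef_def spin_rep_mult rel)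
qed (simp_all add: fscale_def)

text \<open>
  The spin \<open>0\<close> representation is the counit.  This puts the unit of \<open>\<A>\<close> among the matrix
  coefficients, and makes the counit multiplicative because representations are.
\<close>

lemma spin_rep_trivial: 
  assumes "0 < q"
  shows "spin_rep q 0 h (spin_basis 0) = fscale (counit h) (spin_basis 0)"
proof -
  have idx: "spin_index 0 = {0}" by (auto simp: spin_index_def)
  have gen: "spin_op q 0 g (spin_basis 0) = fscale (counit_gen g) (spin_basis 0)" for g
    using assms by (cases g) (simp_all add: spin_op_def idx fscale_def spin_basis_def fun_eq_iff)
  have "foldr (spin_op q 0) w (spin_basis 0) = fscale (prod_list (map counit_gen w)) (spin_basis 0)" for w
    by (induction w) (simp_all add: gen spin_op_scale fscale_fscale mult.commute)
  then show ?thesis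
    by (simp add: spin_rep_def counit_def fscale_def fun_eq_iff sum_fun_apply sum_distrib_right mult.assoc)
qed

lemma spin_basis_0: "spin_basis 0 \<in> spin_space 0" "spin_inner 0 (spin_basis 0) (spin_basis 0) = 1"
proof -
  have idx: "spin_index 0 = {0}" by (auto simp: spin_index_def)
  show "spin_basis 0 \<in> spin_space 0" "spin_inner 0 (spin_basis 0) (spin_basis 0) = 1"
    by (simp_all add: spin_space_def spin_inner_def spin_basis_def idx)
qed

lemma counit_eq_matcoef:
  assumes "0 < q"
  shows "counit = matcoef q 0 (spin_basis 0) (spin_basis 0)"
  by (simp add: fun_eq_iff matcoef_def spin_rep_trivial[OF assms] spin_inner_linear spin_basis_0)

lemma counit_in_Oq_SU2: "0 < q \<Longrightarrow> counit \<in> Oq_SU2 q"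
  using matcoef_in_Oq_SU2[OF _ spin_basis_0(1) spin_basis_0(1), of q] counit_eq_matcoef[of q]
  by (force simp: half_integral_def)

lemma counit_gens: "counit (gen g) = counit_gen g" "counit (cst c) = c" "counit 1 = 1"
proof -
  show "counit (gen g) = counit_gen g" by (simp add: counit_def gen_def)
  show *: "counit (cst c) = c" for c by (simp add: counit_def flip: single_Nil)
  show "counit 1 = 1" using *[of 1] by simp
qed

lemma counit_mult: "counit (g * h) = counit g * counit h"
proof -
  \<comment> \<open>The counit does not involve the deformation parameter, so any positive value will do.\<close>
  have "0 < (1::real)" by simp
  note t = spin_rep_trivial[OF this]
  have "spin_inner 0 (spin_basis 0) (spin_rep 1 0 (g * h) (spin_basis 0)) = counit g * counit h"
    by (simp add: spin_rep_mult t spin_rep_vec_scale spin_inner_linear spin_basis_0)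
  then show ?thesis by (simp add: t spin_inner_linear spin_basis_0)
qed

lemma counit_add: "counit (g + h) = counit g + counit h"
  using Oq_SU2_linear(1)[OF counit_in_Oq_SU2[of 1]] by simp

lemma counit_diff: "counit (g - h) = counit g - counit h"
  using counit_add[of "g - h" h] by simp

lemma counit_uminus: "counit (- h) = - counit h"
  using counit_diff[of 0 h] counit_diff[of 0 0] by simp

lemmas counit_simps = counit_gens counit_mult counit_add counit_diff counit_uminus


section \<open>The involution preserves the span of the matrix coefficients\<close>

text \<open>
  The antilinear map \<open>\<xi>\<^sub>j \<mapsto> \<plusminus> q\<^sup>-\<^sup>j \<xi>\<^sub>-\<^sub>j\<close> with alternating signs, which intertwines \<open>h\<close> with \<open>S(h)\<^sup>*\<close>.
  Indices are real numbers, and the cosine alternates in sign along every sequence with step one.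
\<close>

definition spin_conj :: "real \<Rightarrow> real \<Rightarrow> (real \<Rightarrow> complex) \<Rightarrow> (real \<Rightarrow> complex)" where
  "spin_conj q s \<eta> = (\<lambda>i. of_real (cos (pi * (s - i)) * q powr i) * cnj (\<eta> (- i)))"

lemma spin_conj_in_space:
  "half_integral s \<Longrightarrow> \<eta> \<in> spin_space s \<Longrightarrow> spin_conj q s \<eta> \<in> spin_space s"
  by (auto simp: spin_space_def spin_conj_def spin_index_ladder)

lemma star_antipode_mult: "star (antipode (g * h)) = star (antipode g) * star (antipode h)"
  by (simp add: S.ext_mult star.ext_mult)

text \<open>
  On the generators \<open>S(k)\<^sup>* = k\<^sup>-\<^sup>1\<close>, \<open>S(e)\<^sup>* = - f\<close> and \<open>S(f)\<^sup>* = - e\<close>.  Reflecting the index exchanges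
  the coefficients of \<open>e\<close> and \<open>f\<close> up to a factor \<open>q\<close>, which is absorbed by the weight \<open>q\<^sup>i\<close>, and the
  minus sign is absorbed by the alternating sign.
\<close>

lemma spin_conj_gen:
  assumes q: "0 < q" and s: "half_integral s" and \<eta>: "\<eta> \<in> spin_space s"
  shows "spin_op q s g (spin_conj q s \<eta>) = spin_conj q s (spin_rep q s (star (antipode (gen g))) \<eta>)"
proof -
  note sp = spin_op_in_space[OF s \<eta>]
  have \<theta>: "spin_conj q s \<eta> \<in> spin_space s" by (rule spin_conj_in_space[OF s \<eta>])
  have sgn: "cos (pi * (s - (i - 1))) = - cos (pi * (s - i))"
    "cos (pi * (s - (i + 1))) = - cos (pi * (s - i))" for i
    by (simp_all add: algebra_simps cos_add cos_diff sin_diff)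
  \<comment> \<open>On the nose, \<open>S(e)\<^sup>* = - f k k\<^sup>-\<^sup>1\<close> and \<open>S(f)\<^sup>* = - k k\<^sup>-\<^sup>1 e\<close> in the free algebra.\<close>
  have FKKi: "spin_rep q s (star (antipode (gen QE))) \<eta> = - spin_op q s QF \<eta>"
    by (simp add: S.ext_simps star.ext_simps spin_rep_simps spin_op_relations[OF q s \<eta>]
        spin_op_relations[OF q s sp])
  have KKiE: "spin_rep q s (star (antipode (gen QF))) \<eta> = - spin_op q s QE \<eta>"
    by (simp add: S.ext_simps star.ext_simps spin_rep_simps spin_op_relations[OF q s \<eta>]
        spin_op_relations[OF q s sp])
  show ?thesis
  proof (cases g)
    case QK
    then show ?thesis unfolding QK spin_op_eval[OF \<theta>]
      by (simp add: S.ext_simps star.ext_simps spin_rep_simps spin_op_eval[OF \<eta>])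
        (simp add: spin_conj_def fun_eq_iff)
  next
    case QKi
    then show ?thesis unfolding QKi spin_op_eval[OF \<theta>]
      by (simp add: S.ext_simps star.ext_simps spin_rep_simps spin_op_eval[OF \<eta>])
        (simp add: spin_conj_def fun_eq_iff)
  next
    case QE
    show ?thesis unfolding QE spin_op_eval[OF \<theta>] FKKi spin_op_eval[OF \<eta>] unfolding spin_conj_def sgn
      by (simp add: fun_eq_iff mult_ac)
  next
    case QF
    show ?thesis unfolding QF spin_op_eval[OF \<theta>] KKiE spin_op_eval[OF \<eta>] unfolding spin_conj_def sgn
      using q by (simp add: fun_eq_iff powr_add powr_diff powr_minus mult_ac)
  qed
qed

lemma spin_conj_antilinear:
  "spin_conj q s (\<eta> + \<xi>) = spin_conj q s \<eta> + spin_conj q s \<xi>"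
  "spin_conj q s (fscale c \<eta>) = fscale (cnj c) (spin_conj q s \<eta>)"
  "spin_conj q s 0 = 0"
  by (simp_all add: spin_conj_def fscale_def fun_eq_iff distrib_left)

lemma spin_conj_intertwines:
  assumes q: "0 < q" and s: "half_integral s" and \<eta>: "\<eta> \<in> spin_space s"
  shows "spin_rep q s h (spin_conj q s \<eta>) = spin_conj q s (spin_rep q s (star (antipode h)) \<eta>)"
proof (induction h rule: free_monomial_induct)
  case zero
  show ?case using S.ext_diff[of 0 0] star.ext_diff[of 0 0]
    by (simp add: spin_conj_antilinear del: zero_fun_apply)
next
  case (monomial w c)
  show ?case
  proof (induction w)
    case Nil
    show ?case by (simp add: single_Nil S.ext_cst star.ext_cst spin_rep_cst spin_conj_antilinear)
  next
    case (Cons g w)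
    let ?\<zeta> = "spin_rep q s (star (antipode (Poly_Mapping.single w c))) \<eta>"
    have "?\<zeta> \<in> spin_space s" by (rule spin_rep_in_space[OF s \<eta>])
    from spin_conj_gen[OF q s this, of g] Cons show ?case
      by (simp add: single_Cons spin_rep_mult spin_rep_gen star_antipode_mult)
  qed
next
  case (add x y)
  then show ?case
    by (simp add: S.ext_add star.ext_add spin_rep_add spin_conj_antilinear del: plus_fun_apply)
qed

text \<open>
  The two weights \<open>q\<^sup>i\<close> and \<open>(q\<^sup>-\<^sup>1)\<^sup>i\<close> cancel, and so do the two equal signs; what is left is the
  substitution \<open>i \<mapsto> - i\<close> in the sum.
\<close>

lemma spin_inner_conj:
  assumes q: "0 < q" and s: "half_integral s"
  shows "cnj (spin_inner s \<xi> \<eta>) = spin_inner s (spin_conj (inverse q) s \<xi>) (spin_conj q s \<eta>)"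
proof -
  have sign: "cos (pi * (s - i)) * cos (pi * (s - i)) = 1" if i: "i \<in> spin_index s" for i
  proof -
    obtain m where "i = - s + real m" using i unfolding spin_index_def by blast
    moreover obtain n where "s = real n / 2" using s by (auto simp: half_integral_def)
    ultimately have "s - i = of_int (int n - int m)" by simp
    then have "sin (pi * (s - i)) = 0" by (metis sin_npi_int mult.commute)
    then show ?thesis using sin_cos_squared_add[of "pi * (s - i)"] by (simp add: power2_eq_square)
  qed
  have "cnj (spin_inner s \<xi> \<eta>) = (\<Sum>i\<in>spin_index s. \<xi> (- i) * cnj (\<eta> (- i)))"
    unfolding spin_inner_def cnj_sum
    by (rule sum.reindex_bij_witness[of _ uminus uminus]) (auto simp: spin_index_ladder[OF s])
  also have "\<dots> = spin_inner s (spin_conj (inverse q) s \<xi>) (spin_conj q s \<eta>)"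
    unfolding spin_inner_def
  proof (rule sum.cong)
    fix i assume i: "i \<in> spin_index s"
    let ?c = "cos (pi * (s - i)) * inverse q powr i" and ?d = "cos (pi * (s - i)) * q powr i"
    have "inverse q powr i * q powr i = 1" using q by (simp flip: powr_mult)
    moreover have "?c * ?d = (cos (pi * (s - i)) * cos (pi * (s - i))) * (inverse q powr i * q powr i)"
      by (simp only: ac_simps)
    ultimately have "?c * ?d = 1" by (simp only: sign[OF i])
    then have cd: "complex_of_real ?c * complex_of_real ?d = 1"
      by (metis of_real_1 of_real_mult)
    have "cnj (spin_conj (inverse q) s \<xi> i) * spin_conj q s \<eta> i
        = (complex_of_real ?c * complex_of_real ?d) * (\<xi> (- i) * cnj (\<eta> (- i)))"
      by (simp add: spin_conj_def ac_simps)
    then show "\<xi> (- i) * cnj (\<eta> (- i)) = cnj (spin_conj (inverse q) s \<xi> i) * spin_conj q s \<eta> i"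
      unfolding cd by simp
  qed simp
  finally show ?thesis .
qed

lemma dual_star_in_Oq_SU2:
  assumes q: "0 < q" and x: "x \<in> Oq_SU2 q"
  shows "dual_star x \<in> Oq_SU2 q"
  using x
proof (induction rule: Oq_SU2_induct)
  case zero
  have "dual_star 0 = 0" by (simp add: dual_star_def fun_eq_iff)
  then show ?case using Oq_SU2_closed(2)[OF x, of 0] by (simp del: zero_fun_apply)
next
  case (add x y)
  have "dual_star (x + y) = dual_star x + dual_star y" by (simp add: dual_star_def fun_eq_iff)
  then show ?case using add Oq_SU2_closed(1) by metis
next
  case (scale c x)
  have "dual_star (fscale c x) = fscale (cnj c) (dual_star x)"
    by (simp add: dual_star_def fscale_def fun_eq_iff)
  then show ?case using scale Oq_SU2_closed(2) by metis
next
  case (matcoef s \<xi> \<eta>)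
  have "dual_star (matcoef q s \<xi> \<eta>) = matcoef q s (spin_conj (inverse q) s \<xi>) (spin_conj q s \<eta>)"
    using matcoef
    by (simp add: fun_eq_iff dual_star_def matcoef_def spin_inner_conj[OF q] spin_conj_intertwines[OF q])
  then show ?case
    using matcoef by (auto intro: matcoef_in_Oq_SU2 spin_conj_in_space)
qed



section \<open>The sphere is a unital subspace closed under the involution\<close>

lemma podles_closed:
  shows "x \<in> podles q a \<Longrightarrow> y \<in> podles q a \<Longrightarrow> x + y \<in> podles q a"
    and "x \<in> podles q a \<Longrightarrow> fscale c x \<in> podles q a"
proof -
  have "left_act h (x + y) = left_act h x + left_act h y" "left_act h (fscale c x) = fscale c (left_act h x)"
    for h by (simp_all add: left_act_def fscale_def fun_eq_iff)
  then show "x \<in> podles q a \<Longrightarrow> y \<in> podles q a \<Longrightarrow> x + y \<in> podles q a"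
    and "x \<in> podles q a \<Longrightarrow> fscale c x \<in> podles q a"
    by (simp_all add: podles_def Oq_SU2_closed fscale_add fscale_fscale mult.commute del: plus_fun_apply)
qed

lemma counit_B_t:
  "counit (B_t q a) = - (\<i> * of_real (inverse (q - inverse q) * t_par q a))"
  by (simp add: B_t_def counit_simps)

lemma cnj_counit_B_t: "cnj (counit (B_t q a)) = - counit (B_t q a)"
  by (simp add: counit_B_t)

lemma RB_t_eq:
  "RB_t q a = cst (of_real (q powr (- 1 / 2))) *
     (gen QKi * (cst (of_real (inverse q)) * gen QF * gen QK) - cst (of_real q) * gen QKi * gen QE)
   + cst (counit (B_t q a)) * gen QKi"
proof -
  let ?c = "\<i> * of_real (inverse (q - inverse q) * t_par q a)"
  have "RB_t q a = (- (cst (of_real q) * gen QKi * gen QE)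
      + gen QKi * (cst (of_real (inverse q)) * gen QF * gen QK)) * cst (of_real (q powr (- 1 / 2)))
    - gen QKi * cst ?c"
    by (simp add: RB_t_def B_t_def R.ext_simps)
  moreover have "cst (- ?c) = - (cst ?c :: free_alg)"
    by (simp add: cst_def single_uminus)
  ultimately show ?thesis unfolding counit_B_t by (simp add: cst_commute[symmetric])
qed

lemma counit_RB_t: "counit (RB_t q a) = counit (B_t q a)"
  by (simp add: RB_t_eq counit_simps)

text \<open>
  This identity makes the condition \<open>x(g R(B\<^sub>t)) = \<epsilon>(B\<^sub>t) x(g)\<close> that defines the sphere compatible with the
  involution: under it the two terms with \<open>k\<close> cancel, and what remains says that \<open>x(g S(R(B\<^sub>t))\<^sup>*)\<close> is
  \<open>- \<epsilon>(B\<^sub>t) x(g)\<close>, where \<open>- \<epsilon>(B\<^sub>t)\<close> is the conjugate of \<open>\<epsilon>(B\<^sub>t)\<close>.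
\<close>

lemma star_antipode_RB_t:
  assumes q: "0 < q" and s: "half_integral s" and \<eta>: "\<eta> \<in> spin_space s"
  shows "spin_rep q s (star (antipode (RB_t q a))) \<eta> =
    spin_rep q s (gen QK * RB_t q a - cst (counit (B_t q a)) - cst (counit (B_t q a)) * gen QK) \<eta>"
proof -
  note sp = spin_op_in_space[OF s \<eta>]
  note sp2 = spin_op_in_space[OF s sp]
  note rel = spin_op_relations[OF q s \<eta>] spin_op_relations[OF q s sp] spin_op_relations[OF q s sp2]
    spin_op_scale spin_op_add spin_op_diff fscale_fscale
  show ?thesis
    unfolding RB_t_eq
    using q
    by (simp add: S.ext_simps star.ext_simps spin_rep_simps rel cnj_counit_B_t del: plus_fun_apply)
       (simp add: fscale_def fun_eq_iff field_simps power2_eq_square)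
qed

lemma dual_star_in_podles:
  assumes q: "0 < q" and x: "x \<in> podles q a"
  shows "dual_star x \<in> podles q a"
proof -
  let ?\<epsilon> = "counit (B_t q a)"
  have xO: "x \<in> Oq_SU2 q" and inv: "x (g * RB_t q a) = ?\<epsilon> * x g" for g
    using x by (auto simp: podles_def left_act_def fscale_def fun_eq_iff)
  have "left_act (RB_t q a) (dual_star x) g = ?\<epsilon> * dual_star x g" for g
  proof -
    let ?g = "star (antipode g)"
    have "x (star (antipode (g * RB_t q a)))
        = x (?g * (gen QK * RB_t q a - cst ?\<epsilon> - cst ?\<epsilon> * gen QK))"
      unfolding star_antipode_mult by (rule Oq_SU2_cong[OF xO star_antipode_RB_t[OF q]])
    also have "?g * (gen QK * RB_t q a - cst ?\<epsilon> - cst ?\<epsilon> * gen QK)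
        = (?g * gen QK) * RB_t q a + cst (- ?\<epsilon>) * ?g + cst (- ?\<epsilon>) * (?g * gen QK)"
    proof -
      have "?g * (cst ?\<epsilon> * gen QK) = cst ?\<epsilon> * (?g * gen QK)"
        by (metis cst_commute mult.assoc)
      moreover have "cst (- ?\<epsilon>) = - (cst ?\<epsilon> :: free_alg)"
        by (simp add: cst_def single_uminus)
      ultimately show ?thesis by (simp add: right_diff_distrib mult.assoc cst_commute)
    qed
    also have "x \<dots> = - ?\<epsilon> * x ?g"
      by (simp only: Oq_SU2_linear[OF xO] inv) simp
    finally show ?thesis
      by (simp add: left_act_def dual_star_def cnj_counit_B_t)
  qed
  then show ?thesis
    using dual_star_in_Oq_SU2[OF q xO] by (auto simp: podles_def fscale_def fun_eq_iff)
qed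

lemma counit_in_podles: "0 < q \<Longrightarrow> counit \<in> podles q a"
  by (simp add: podles_def counit_in_Oq_SU2 left_act_def fscale_def fun_eq_iff counit_mult
      counit_RB_t)

lemma dual_counit_centre: "dual_counit (centre x) = 0"
  by (simp add: dual_counit_def centre_def fscale_def counit_gens)

lemma centre_in_podles:
  assumes "0 < q" and "x \<in> podles q a"
  shows "centre x \<in> podles q a"
proof -
  have "centre x = x + fscale (- dual_counit x) counit"
    by (simp add: centre_def fscale_def fun_eq_iff)
  then show ?thesis using assms podles_closed counit_in_podles by metis
qed

lemma dual_counit_mult: "dual_counit (dual_mult x y) = dual_counit x * dual_counit y"
proof -
  have "Delta (Poly_Mapping.single [] 1) = 1"
    by (simp add: Delta_def)
  then have "Delta 1 = 1" by (simp add: single_Nil)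
  then show ?thesis by (simp add: dual_counit_def dual_mult_def split_beta)
qed


section \<open>The cocycle\<close>

text \<open>
  Everything rests on \<open>C(x) = \<pi>(x - \<epsilon>(x) 1) e\<close>: it makes \<open>C\<close> linear, identifies its range as
  \<open>ker(\<epsilon>) e\<close>, and turns inner products of cocycle vectors into values of a vector state.
\<close>

lemma double_module_cocycle:
  assumes q: "0 < q" and V: "double_module q a V \<pi> \<rho>" and e: "e \<in> carrier V"
    and x: "x \<in> podles q a"
  shows "cocycle V \<pi> e x = \<pi> (centre x) e" and "cocycle V \<pi> e x \<in> carrier V"
    and "y \<in> podles q a \<Longrightarrow> cocycle V \<pi> e (x + y) = cocycle V \<pi> e x \<oplus>\<^bsub>V\<^esub> cocycle V \<pi> e y"
    and "cocycle V \<pi> e (fscale c x) = c \<odot>\<^bsub>V\<^esub> cocycle V \<pi> e x"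
proof -
  interpret V: module complex_ring V using V by (simp add: double_module_def)
  have rep: "algebra_rep (podles q a) fscale dual_mult counit V \<pi>"
    using V by (simp add: double_module_def)
  have cl: "\<pi> b v \<in> carrier V" if "b \<in> podles q a" "v \<in> carrier V" for b v
    using rep that by (auto simp: algebra_rep_def linear_map_on_def)
  have add: "\<pi> (b + b') e = \<pi> b e \<oplus>\<^bsub>V\<^esub> \<pi> b' e" if "b \<in> podles q a" "b' \<in> podles q a" for b b'
    using rep that e by (auto simp: algebra_rep_def)
  have scale: "\<pi> (fscale d b) e = d \<odot>\<^bsub>V\<^esub> \<pi> b e" if "b \<in> podles q a" for d b
    using rep that e by (auto simp: algebra_rep_def)
  have unit: "\<pi> counit e = e"
    using rep e by (auto simp: algebra_rep_def)
  have R: "carrier complex_ring = UNIV" by (simp add: complex_ring_def)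
  have eq: "cocycle V \<pi> e y = \<pi> (centre y) e" if y: "y \<in> podles q a" for y
  proof -
    note c = counit_in_podles[OF q, of a]
    have y': "y = centre y + fscale (dual_counit y) counit" by (simp add: centre_def)
    have "\<pi> y e = \<pi> (centre y + fscale (dual_counit y) counit) e" using y' by simp
    also have "\<dots> = \<pi> (centre y) e \<oplus>\<^bsub>V\<^esub> dual_counit y \<odot>\<^bsub>V\<^esub> e"
      by (simp add: add[OF centre_in_podles[OF q y] podles_closed(2)[OF c]] scale[OF c] unit)
    finally show ?thesis
      using cl[OF centre_in_podles[OF q y] e] e
      by (simp add: cocycle_def R V.minus_eq V.a_assoc V.r_neg)
  qed
  show "cocycle V \<pi> e x = \<pi> (centre x) e" by (rule eq[OF x])
  show "cocycle V \<pi> e x \<in> carrier V" using cl[OF centre_in_podles[OF q x] e] eq[OF x] by simp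
  show "cocycle V \<pi> e (x + y) = cocycle V \<pi> e x \<oplus>\<^bsub>V\<^esub> cocycle V \<pi> e y" if y: "y \<in> podles q a"
  proof -
    have "centre (x + y) = centre x + centre y"
      by (simp add: centre_def dual_counit_def fscale_def fun_eq_iff algebra_simps)
    then show ?thesis
      using add[OF centre_in_podles[OF q x] centre_in_podles[OF q y]]
      by (simp only: eq x y podles_closed)
  qed
  show "cocycle V \<pi> e (fscale c x) = c \<odot>\<^bsub>V\<^esub> cocycle V \<pi> e x"
  proof -
    have "centre (fscale c x) = fscale c (centre x)"
      by (simp add: centre_def dual_counit_def fscale_def fun_eq_iff algebra_simps)
    then show ?thesis
      using scale[OF centre_in_podles[OF q x]] by (simp only: eq x podles_closed)
  qed
qed

lemma cocycle_image:
  assumes q: "0 < q" and V: "double_module q a V \<pi> \<rho>" and e: "e \<in> carrier V"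
  shows "cocycle V \<pi> e ` podles q a = {\<pi> b e | b. b \<in> podles q a \<and> dual_counit b = 0}"
proof -
  have "centre b = b" if "dual_counit b = 0" for b
    using that by (simp add: centre_def fscale_def fun_eq_iff)
  then show ?thesis
    using double_module_cocycle(1)[OF q V e] centre_in_podles[OF q] dual_counit_centre
    by (auto simp: image_iff) metis+
qed


section \<open>The limits defining the two inner products\<close>

lemma inner_cocycle_eq_omega:
  assumes q: "0 < q" and L: "is_L_plus q a \<eta> l (V l) (\<pi> l) (\<rho> l) (e l)"
    and x: "x \<in> podles q a" and y: "y \<in> podles q a"
  shows "inner_prod (V l) (cocycle (V l) (\<pi> l) (e l) x) (cocycle (V l) (\<pi> l) (e l) y)
    = omega V \<pi> e l (dual_mult (dual_star (centre x)) (centre y))"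
proof -
  have adm: "admissible q a (V l) (\<pi> l) (\<rho> l)" and e: "e l \<in> carrier (V l)"
    using L by (auto simp: is_L_plus_def weight_space_def)
  have dm: "double_module q a (V l) (\<pi> l) (\<rho> l)" using adm by (simp add: admissible_def)
  have rep: "algebra_rep (podles q a) fscale dual_mult counit (V l) (\<pi> l)"
    using dm by (simp add: double_module_def)
  note x0 = centre_in_podles[OF q x] and y0 = centre_in_podles[OF q y]
  have cl: "\<pi> l (centre y) (e l) \<in> carrier (V l)"
    using double_module_cocycle(1,2)[OF q dm e y] by simp
  have "inner_prod (V l) (\<pi> l (centre x) (e l)) (\<pi> l (centre y) (e l))
      = inner_prod (V l) (e l) (\<pi> l (dual_star (centre x)) (\<pi> l (centre y) (e l)))"
    using adm x0 e cl by (simp add: admissible_def)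
  also have "\<pi> l (dual_star (centre x)) (\<pi> l (centre y) (e l))
      = \<pi> l (dual_mult (dual_star (centre x)) (centre y)) (e l)"
    using rep dual_star_in_podles[OF q x0] y0 e by (simp add: algebra_rep_def)
  finally show ?thesis
    using double_module_cocycle(1)[OF q dm e] x y by (simp add: omega_def)
qed

lemma kappa_pos: "0 < q \<Longrightarrow> 0 < kappa q a"
  by (simp add: kappa_def qbrace_def add_pos_pos)

text \<open>
  By the previous lemma the two difference quotients agree for all \<open>\<lambda>\<close> in \<open>(0, q + q\<^sup>-\<^sup>1)\<close>, up to the
  factor \<open>\<kappa>\<close>.  Convergence of the first one gives the existence of the limit in the definition of \<open>L\<close>
  at \<open>x\<^sub>0\<^sup>* y\<^sub>0\<close>; here \<open>\<kappa> \<noteq> 0\<close> matters, as it stands outside that limit.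
\<close>

lemma form_L_eq_limit:
  assumes q: "0 < q"
    and L: "\<And>l. 0 < l \<Longrightarrow> l < q + inverse q \<Longrightarrow> is_L_plus q a \<eta> l (V l) (\<pi> l) (\<rho> l) (e l)"
    and x: "x \<in> podles q a" and y: "y \<in> podles q a"
    and lim: "((\<lambda>l. of_real (kappa q a) *
            inner_prod (V l) (cocycle (V l) (\<pi> l) (e l) x) (cocycle (V l) (\<pi> l) (e l) y)
            / of_real (q + inverse q - l)) \<longlongrightarrow> z) (at_left (q + inverse q))"
  shows "form_L (gen_functional q a V \<pi> e) x y = z"
proof -
  let ?b = "dual_mult (dual_star (centre x)) (centre y)"
  let ?k = "complex_of_real (kappa q a)"
  have k: "?k \<noteq> 0" using kappa_pos[OF q, of a] by simp
  have "0 < q + inverse q" using q by (simp add: add_pos_pos)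
  then have ev: "eventually (\<lambda>l. l \<in> {0<..<q + inverse q}) (at_left (q + inverse q))"
    by (rule eventually_at_left_real)
  have "((\<lambda>l. (omega V \<pi> e l ?b - dual_counit ?b) / of_real (q + inverse q - l)) \<longlongrightarrow> z / ?k)
      (at_left (q + inverse q))"
  proof (rule Lim_transform_eventually[OF tendsto_divide[OF lim tendsto_const k]])
    show "\<forall>\<^sub>F l in at_left (q + inverse q).
        ?k * inner_prod (V l) (cocycle (V l) (\<pi> l) (e l) x) (cocycle (V l) (\<pi> l) (e l) y)
          / of_real (q + inverse q - l) / ?k
        = (omega V \<pi> e l ?b - dual_counit ?b) / of_real (q + inverse q - l)"
      using ev
    proof eventually_elim
      case (elim l)
      then show ?case
        using inner_cocycle_eq_omega[where V = V and \<pi> = \<pi> and \<rho> = \<rho> and e = e, OF q L x y] k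
        by (simp add: dual_counit_mult dual_counit_centre)
    qed
  qed
  then have "Lim (at_left (q + inverse q))
      (\<lambda>l. (omega V \<pi> e l ?b - dual_counit ?b) / of_real (q + inverse q - l)) = z / ?k"
    by (intro tendsto_Lim) simp_all
  then show ?thesis using k by (simp add: form_L_def gen_functional_def)
qed


section \<open>Uniqueness of the Gelfand-Naimark-Segal construction\<close>

text \<open>
  Since the form of \<open>K\<close> is definite, \<open>N\<^sub>L\<close> is the kernel of \<open>C\<close> and the cosets are the fibres of \<open>C\<close>.
  So \<open>C\<close> induces a bijection of \<open>\<H>\<^sub>L\<close> with \<open>K\<close> that carries all operations over, and every axiom of a
  pre-Hilbert space holds for \<open>\<H>\<^sub>L\<close> because it holds for \<open>K\<close> or for the functionals on representatives.
\<close>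

lemma gns_uniqueness:
  fixes K :: "'w prehilbert" and C :: "dual \<Rightarrow> 'w"
  assumes K: "prehilbert_space K"
    and B0: "0 \<in> B" and B_add: "\<And>x y. x \<in> B \<Longrightarrow> y \<in> B \<Longrightarrow> x + y \<in> B"
    and B_scale: "\<And>c x. x \<in> B \<Longrightarrow> fscale c x \<in> B"
    and C_add: "\<And>x y. x \<in> B \<Longrightarrow> y \<in> B \<Longrightarrow> C (x + y) = C x \<oplus>\<^bsub>K\<^esub> C y"
    and C_scale: "\<And>c x. x \<in> B \<Longrightarrow> C (fscale c x) = c \<odot>\<^bsub>K\<^esub> C x"
    and C_onto: "C ` B = carrier K"
    and form: "\<And>x y. x \<in> B \<Longrightarrow> y \<in> B \<Longrightarrow> form_L L x y = inner_prod K (C x) (C y)"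
  shows "\<exists>U. unitary_operator (H_L B L) K U \<and> (\<forall>b\<in>B. C b = U (C_L B L b))"
proof -
  interpret K: prehilbert_space K by (rule K)
  have R: "carrier complex_ring = UNIV" by (simp add: complex_ring_def)
  have C_in: "C x \<in> carrier K" if "x \<in> B" for x using C_onto that by auto
  have diff: "y - x \<in> B" "C (y - x) = \<zero>\<^bsub>K\<^esub> \<longleftrightarrow> C y = C x" if "x \<in> B" "y \<in> B" for x y
  proof -
    have m: "y - x = y + fscale (- 1) x" by (simp add: fscale_def fun_eq_iff)
    show yx: "y - x \<in> B" unfolding m using that by (intro B_add B_scale)
    have "C y = C (y - x) \<oplus>\<^bsub>K\<^esub> C x" using C_add[OF yx that(1)] by simp
    then show "C (y - x) = \<zero>\<^bsub>K\<^esub> \<longleftrightarrow> C y = C x"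
      using C_in[OF yx] C_in[OF that(1)] K.add.right_cancel[of "C x" "C (y - x)" "\<zero>\<^bsub>K\<^esub>"] by simp
  qed
  have null: "inner_prod K v v = 0 \<longleftrightarrow> v = \<zero>\<^bsub>K\<^esub>" if "v \<in> carrier K" for v
  proof
    show "v = \<zero>\<^bsub>K\<^esub>" if "inner_prod K v v = 0"
      using K.inner_pos[OF \<open>v \<in> carrier K\<close>] that by fastforce
    show "inner_prod K v v = 0" if "v = \<zero>\<^bsub>K\<^esub>"
      using K.inner_smult[OF K.zero_closed K.zero_closed, of 0] K.smult_r_null[of 0] that by (simp add: R)
  qed
  have coset: "C_L B L x = {y \<in> B. C y = C x}" if x: "x \<in> B" for x
  proof -
    have "y - x \<in> null_L B L \<longleftrightarrow> C y = C x" if y: "y \<in> B" for y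
      using diff[OF x y] C_in[of "y - x"]
      by (simp add: null_L_def form null)
    then show ?thesis by (auto simp: C_L_def)
  qed
  have C_0: "C 0 = \<zero>\<^bsub>K\<^esub>"
    using diff(2)[OF B0 B0] by simp
  define H where "H = H_L B L"
  define U where "U X = the_elem (C ` X)" for X
  have U: "U (C_L B L x) = C x" if "x \<in> B" for x
  proof -
    have "C ` C_L B L x = {C x}" using that by (auto simp: coset)
    then show ?thesis by (simp add: U_def)
  qed
  have eq: "C_L B L x = C_L B L y \<longleftrightarrow> C x = C y" if "x \<in> B" "y \<in> B" for x y
    using that by (auto simp: coset)
  have H_carrier: "carrier H = C_L B L ` B" by (simp add: H_def H_L_def)
  have H_zero: "\<zero>\<^bsub>H\<^esub> = C_L B L 0" by (simp add: H_def H_L_def)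
  have H_add: "C_L B L x \<oplus>\<^bsub>H\<^esub> C_L B L y = C_L B L (x + y)" if x: "x \<in> B" and y: "y \<in> B" for x y
  proof -
    have "C_L B L (x' + y') = C_L B L (x + y)" if "x' \<in> C_L B L x" "y' \<in> C_L B L y" for x' y'
      using that x y by (simp add: coset[OF x] coset[OF y] eq B_add C_add)
    moreover have "C_L B L x \<noteq> {}" "C_L B L y \<noteq> {}" using x y by (auto simp: coset)
    ultimately have "(\<Union>x'\<in>C_L B L x. \<Union>y'\<in>C_L B L y. C_L B L (x' + y')) = C_L B L (x + y)"
      by simp
    then show ?thesis by (simp add: H_def H_L_def)
  qed
  have H_smult: "c \<odot>\<^bsub>H\<^esub> C_L B L x = C_L B L (fscale c x)" if x: "x \<in> B" for c x
  proof -
    have "C_L B L (fscale c x') = C_L B L (fscale c x)" if "x' \<in> C_L B L x" for x'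
      using that x by (simp add: coset[OF x] eq B_scale C_scale)
    moreover have "C_L B L x \<noteq> {}" using x by (auto simp: coset)
    ultimately have "(\<Union>x'\<in>C_L B L x. C_L B L (fscale c x')) = C_L B L (fscale c x)"
      by simp
    then show ?thesis by (simp add: H_def H_L_def)
  qed
  have H_inner: "inner_prod H (C_L B L x) (C_L B L y) = inner_prod K (C x) (C y)"
    if x: "x \<in> B" and y: "y \<in> B" for x y
  proof -
    have "(\<Union>x'\<in>C_L B L x. \<Union>y'\<in>C_L B L y. {form_L L x' y'}) = {inner_prod K (C x) (C y)}"
      using x y by (force simp: coset form)
    then show ?thesis by (simp add: H_def H_L_def)
  qed
  note H_ops = H_zero H_add H_smult H_inner
  have H: "prehilbert_space H"
  proof (intro prehilbert_space.intro prehilbert_space_axioms.intro moduleI)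
    show "cring complex_ring" by (rule K.is_cring)
    show "abelian_group H"
    proof (rule abelian_groupI)
      fix X assume "X \<in> carrier H"
      then obtain x where x: "x \<in> B" "X = C_L B L x" by (auto simp: H_carrier)
      have "C_L B L (fscale (- 1) x) \<oplus>\<^bsub>H\<^esub> X = C_L B L (fscale (- 1) x + x)"
        using x B_scale by (simp only: H_add)
      also have "fscale (- 1) x + x = 0" by (simp add: fscale_def fun_eq_iff)
      finally show "\<exists>Y\<in>carrier H. Y \<oplus>\<^bsub>H\<^esub> X = \<zero>\<^bsub>H\<^esub>"
        using B_scale[OF x(1), of "- 1"] unfolding H_zero H_carrier by (rule bexI[OF _ imageI])
    qed (auto simp: H_carrier H_ops B0 B_add add_ac simp del: plus_fun_apply zero_fun_apply)
    show "0 < Re (inner_prod H X X)" if "X \<in> carrier H" "X \<noteq> \<zero>\<^bsub>H\<^esub>" for X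
    proof -
      obtain x where x: "x \<in> B" "X = C_L B L x" using \<open>X \<in> carrier H\<close> by (auto simp: H_carrier)
      then have "C x \<noteq> \<zero>\<^bsub>K\<^esub>" using \<open>X \<noteq> \<zero>\<^bsub>H\<^esub>\<close> eq[OF x(1) B0] C_0 by (auto simp: H_zero)
      then show ?thesis using x K.inner_pos[OF C_in] by (simp add: H_inner)
    qed
    show "inner_prod H Y X = cnj (inner_prod H X Y)" 
      if XY: "X \<in> carrier H" "Y \<in> carrier H" for X Y
    proof -
      obtain x y where "x \<in> B" "X = C_L B L x" "y \<in> B" "Y = C_L B L y"
        using XY by (auto simp: H_carrier)
      then show ?thesis by (simp only: H_inner K.inner_commute[OF C_in C_in, of x y])
    qed
  qed (auto simp: H_carrier H_ops B_add B_scale C_add C_scale C_in K.inner_add K.inner_smult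
      complex_ring_def fscale_add fscale_add_left fscale_fscale simp del: plus_fun_apply)
  have "unitary_operator H K U"
    unfolding unitary_operator_def linear_map_on_def
  proof (intro conjI H K)
    show "U ` carrier H = carrier K" using C_onto U by (force simp: H_carrier image_image)
  qed (auto simp: H_carrier H_ops U B_add B_scale C_add C_scale C_in simp del: plus_fun_apply)
  then show ?thesis using U by (auto simp: H_def)
qed


section \<open>Unitary equivalence of the two cocycles\<close>

theorem proposition5p6:
  fixes q a :: real
    and \<eta> :: "real \<Rightarrow> complex"
    and V :: "real \<Rightarrow> 'v prehilbert"
    and \<pi> :: "real \<Rightarrow> dual \<Rightarrow> 'v \<Rightarrow> 'v"
    and \<rho> :: "real \<Rightarrow> free_alg \<Rightarrow> 'v \<Rightarrow> 'v"
    and e :: "real \<Rightarrow> 'v"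
    and M :: "(complex, 'w) module"
    and \<pi>M :: "dual \<Rightarrow> 'w \<Rightarrow> 'w"
    and \<rho>M :: "free_alg \<Rightarrow> 'w \<Rightarrow> 'w"
    and eM :: 'w
    and f :: "'w \<Rightarrow> 'w \<Rightarrow> complex"
  assumes "0 < q" and "q < 1"
    and "is_eta1 q a \<eta>"
    and "\<And>l. 0 < l \<Longrightarrow> l < q + inverse q \<Longrightarrow> is_L_plus q a \<eta> l (V l) (\<pi> l) (\<rho> l) (e l)"
    and "is_M_univ q a \<eta> M \<pi>M \<rho>M eM"
    and "is_D2_inner q a V \<pi> e M \<pi>M eM f"
  shows "\<exists>U. unitary_operator
           (H_L (podles q a) (gen_functional q a V \<pi> e)) (D2_sum q a M \<pi>M eM f) U \<and>
         (\<forall>b\<in>podles q a.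
            cocycle M \<pi>M eM b = U (C_L (podles q a) (gen_functional q a V \<pi> e) b))"
proof -
  have inf: "prehilbert_space (D2_sum q a M \<pi>M eM f)"
    and lim: "\<And>x y. x \<in> podles q a \<Longrightarrow> y \<in> podles q a \<Longrightarrow>
        ((\<lambda>l. of_real (kappa q a) *
            inner_prod (V l) (cocycle (V l) (\<pi> l) (e l) x) (cocycle (V l) (\<pi> l) (e l) y)
            / of_real (q + inverse q - l))
         \<longlongrightarrow> f (cocycle M \<pi>M eM x) (cocycle M \<pi>M eM y)) (at_left (q + inverse q))"
    using assms(6) unfolding is_D2_inner_def by blast+
  have M: "double_module q a M \<pi>M \<rho>M" and eM: "eM \<in> carrier M"
    using assms(5) by (auto simp: is_M_univ_def spherical_vector_def weight_space_def)
  note coc = double_module_cocycle[OF assms(1) M eM]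
  have zero: "0 \<in> podles q a"
    using podles_closed(2)[OF counit_in_podles[OF assms(1), of a], of 0] by (simp del: zero_fun_apply)
  show ?thesis
  proof (rule gns_uniqueness[OF inf zero podles_closed])
    show "cocycle M \<pi>M eM ` podles q a = carrier (D2_sum q a M \<pi>M eM f)"
      using cocycle_image[OF assms(1) M eM] by (simp add: D2_sum_def)
    show "form_L (gen_functional q a V \<pi> e) x y
        = inner_prod (D2_sum q a M \<pi>M eM f) (cocycle M \<pi>M eM x) (cocycle M \<pi>M eM y)"
      if "x \<in> podles q a" "y \<in> podles q a" for x y
      using form_L_eq_limit[OF assms(1) assms(4) that lim[OF that]] by (simp add: D2_sum_def)
  qed (simp_all add: D2_sum_def coc(3,4) del: plus_fun_apply)
qed

end
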